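(* Fix $n\ge2$ and let $\mathcal U\subseteq\mathcal T_n$ be an admissible tree set. Every ordered tree $T\in\mathcal U$ satisfies \[ F_{T,\mathbf w}^{\varepsilon}=p+\varepsilon H+\varepsilon^2B_T+o(\varepsilon^2) \] in $\|\cdot\|_{p,\infty}$ as $\varepsilon\to0$, with the remainder uniform over $T\in\mathcal U$, where \[ H=\frac{\sum_{i=1}^nG_ih_i}{\sum_{i=1}^nG_i} \] is independent of $T$, and $B_T$ is the second-order coefficient at the root of $T$ obtained from the second-order recursion.
   Context: $(\Omega,\mathcal F,\mu)$ is a measure space and $p$ a strictly positive probability density with respect to $\mu$. For measurable $q$ with $q/p\in L^\infty(\mu)$, $\|q\|_{p,\infty}=\|q/p\|_\infty$. The real parameter $\varepsilon\ne0$ tends to $0$. Generator: $f:(0,\infty)\to\mathbb R$ is convex and $C^3$ in a neighborhood of $1$, with $f(1)=f'(1)=0$, $f''(1)>0$; $A_2=f''(1)/2$, $A_3=f'''(1)/6$; $D_f(r\|q)=\int_\Omega q f(r/q)\,d\mu$. Coefficient $\tau$: for $a,b>0$ and bounded measurable $u,v$ with $\Delta=v-u$, $J=\int\Delta^2p\,d\mu>0$, $L_3=\int\Delta^3p\,d\mu$, $t_0=\frac{\sqrt b}{\sqrt a+\sqrt b}$, \[ \tau(a,b;u,v)=\frac{A_3L_3\{at_0^3+b(1-t_0)^3\}}{2A_2J\{at_0+b(1-t_0)\}}. \] Trees: $\mathcal T_n$ is the set of full ordered binary trees with $n$ leaves, labelled $1,\dots,n$ from left to right; the block of a node is the set of (consecutive)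 leaves below it, and an internal node merges the adjacent blocks $A$ (left child) and $B$ (right child) into $AB$. Leaves: $\mathbf w=(w_1,\dots,w_n)\in(0,\infty)^n$, $G_i=\sqrt{w_i}$, and the leaf inputs are probability densities $p_i^\varepsilon=p+\varepsilon h_i+\varepsilon^2B_i+o(\varepsilon^2)$ (remainder in $\|\cdot\|_{p,\infty}$) with $\int h_i\,d\mu=\int B_i\,d\mu=0$ and $h_i/p,B_i/p$ bounded. Recursion: for a block, $G_A=\sum_{i\in A}G_i$. At leaves $H_i=h_i$ and the second-order coefficient is $B_i$. When a node merges $A$ and $B$, with $\theta_{AB}=\frac{G_B}{G_A+G_B}$, \[ H_{AB}=\frac{G_AH_A+G_BH_B}{G_A+G_B},\qquad B_{AB}=(1-\theta_{AB})B_A+\theta_{AB}B_B+\tau(G_A^2,G_B^2;H_A/p,H_B/p)(H_B-H_A). \] $B_T$ denotes the resulting coefficient at the root of $T$. Admissibility: a nonempty $\mathcal U\subseteq\mathcal T_n$ is an admissible tree set if, for all trees in $\mathcal U$, all coefficients $H_A,B_A$ generated by the recursion have $H_A/p,B_A/p\in L^\infty(\mu)$ and every generated merge is nondegenerate: $J(A,B)=\int_\Omega\left(\frac{H_B-H_A}{p}\right)^2p\,d\mu>0$. Mass-carrying protocol: for $T\in\mathcal U$, leaf $i$ has state $(G_i,p_i^\varepsilon)$. At a merge of $A$ and $B$, $G_{AB}=G_A+G_B$ and $q_{AB}^\varepsilon=(1-t_{AB}^\varepsilon)q_A^\varepsilon+t_{AB}^\varepsilon q_B^\varepsilon$, where $t_{AB}^\varepsilon\in[0,1]$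 is the local solution of $G_A^2D_f(q_A^\varepsilon\|q_{AB}^\varepsilon)=G_B^2D_f(q_B^\varepsilon\|q_{AB}^\varepsilon)$ converging to $\frac{G_B}{G_A+G_B}$ as $\varepsilon\to0$ (for small $\varepsilon\neq 0$, the unique solution in a fixed small neighborhood of that value). The root density is $F_{T,\mathbf w}^\varepsilon$. *)

theory Defs
  imports "HOL-Probability.Essential_Supremum"
begin

section \<open>Densities, the weighted sup norm and the divergence\<close>

text \<open>Densities are genuine functions, so (strict) positivity is required on the whole space and
  not only almost everywhere. In particular ratios of densities never leave \<open>[0, \<infinity>)\<close>, so the
  values of a generator on the negative reals play no role.\<close>

definition prob_density :: "'a measure \<Rightarrow> ('a \<Rightarrow> real) \<Rightarrow> bool" where
  "prob_density M q \<longleftrightarrow> q \<in> borel_measurable M \<and> (\<forall>x\<in>space M. 0 \<le> q x) \<and>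
     integrable M q \<and> (LINT x|M. q x) = 1"

text \<open>The value is \<open>\<infinity>\<close> for non-measurable functions, so a finite value means that
  \<open>q\<close> is measurable and \<open>q/p\<close> is essentially bounded.\<close>

definition wnorm :: "'a measure \<Rightarrow> ('a \<Rightarrow> real) \<Rightarrow> ('a \<Rightarrow> real) \<Rightarrow> ennreal" where
  "wnorm M p q = (if q \<in> borel_measurable M then esssup M (\<lambda>x. ennreal \<bar>q x / p x\<bar>) else \<infinity>)"

definition fdiv :: "'a measure \<Rightarrow> (real \<Rightarrow> real) \<Rightarrow> ('a \<Rightarrow> real) \<Rightarrow> ('a \<Rightarrow> real) \<Rightarrow> real" where
  "fdiv M f r q = (LINT x|M. q x * f (r x / q x))"

definition generator :: "(real \<Rightarrow> real) \<Rightarrow> bool" where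
  "generator f \<longleftrightarrow>
     convex_on {0<..} f \<and>
     (\<exists>\<delta>>0. (\<forall>k<3. \<forall>x\<in>ball 1 \<delta>. (deriv ^^ k) f field_differentiable (at x)) \<and>
             continuous_on (ball 1 \<delta>) ((deriv ^^ 3) f)) \<and>
     f 1 = 0 \<and> deriv f 1 = 0 \<and> 0 < (deriv ^^ 2) f 1"

definition coeff_A2 :: "(real \<Rightarrow> real) \<Rightarrow> real" where
  "coeff_A2 f = (deriv ^^ 2) f 1 / 2"

definition coeff_A3 :: "(real \<Rightarrow> real) \<Rightarrow> real" where
  "coeff_A3 f = (deriv ^^ 3) f 1 / 6"

definition tau :: "'a measure \<Rightarrow> ('a \<Rightarrow> real) \<Rightarrow> (real \<Rightarrow> real) \<Rightarrow> real \<Rightarrow> real \<Rightarrow>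
    ('a \<Rightarrow> real) \<Rightarrow> ('a \<Rightarrow> real) \<Rightarrow> real" where
  "tau M p f a b u v =
     (let J = (LINT x|M. (v x - u x)^2 * p x);
          L3 = (LINT x|M. (v x - u x)^3 * p x);
          t0 = sqrt b / (sqrt a + sqrt b)
      in coeff_A3 f * L3 * (a * t0^3 + b * (1 - t0)^3) /
         (2 * coeff_A2 f * J * (a * t0 + b * (1 - t0))))"

section \<open>Ordered binary trees\<close>

datatype btree = Leaf nat | Merge btree btree

fun leaves :: "btree \<Rightarrow> nat list" where
  "leaves (Leaf i) = [i]"
| "leaves (Merge l r) = leaves l @ leaves r"

definition trees :: "nat \<Rightarrow> btree set" where
  "trees n = {T. leaves T = [1..<Suc n]}"

fun subtrees :: "btree \<Rightarrow> btree set" where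
  "subtrees (Leaf i) = {Leaf i}"
| "subtrees (Merge l r) = insert (Merge l r) (subtrees l \<union> subtrees r)"

section \<open>First- and second-order recursion\<close>

definition block_mass :: "(nat \<Rightarrow> real) \<Rightarrow> btree \<Rightarrow> real" where
  "block_mass w T = (\<Sum>i\<in>set (leaves T). sqrt (w i))"

fun coeff_H :: "(nat \<Rightarrow> real) \<Rightarrow> (nat \<Rightarrow> 'a \<Rightarrow> real) \<Rightarrow> btree \<Rightarrow> 'a \<Rightarrow> real" where
  "coeff_H w h (Leaf i) = h i"
| "coeff_H w h (Merge l r) =
     (\<lambda>x. (block_mass w l * coeff_H w h l x + block_mass w r * coeff_H w h r x) /
           (block_mass w l + block_mass w r))"

fun coeff_B :: "'a measure \<Rightarrow> ('a \<Rightarrow> real) \<Rightarrow> (real \<Rightarrow> real) \<Rightarrow> (nat \<Rightarrow> real) \<Rightarrow>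
    (nat \<Rightarrow> 'a \<Rightarrow> real) \<Rightarrow> (nat \<Rightarrow> 'a \<Rightarrow> real) \<Rightarrow> btree \<Rightarrow> 'a \<Rightarrow> real" where
  "coeff_B M p f w h B (Leaf i) = B i"
| "coeff_B M p f w h B (Merge l r) =
     (let \<theta> = block_mass w r / (block_mass w l + block_mass w r);
          \<tau> = tau M p f ((block_mass w l)^2) ((block_mass w r)^2)
                (\<lambda>x. coeff_H w h l x / p x) (\<lambda>x. coeff_H w h r x / p x)
      in (\<lambda>x. (1 - \<theta>) * coeff_B M p f w h B l x + \<theta> * coeff_B M p f w h B r x +
               \<tau> * (coeff_H w h r x - coeff_H w h l x)))"

definition admissible :: "'a measure \<Rightarrow> ('a \<Rightarrow> real) \<Rightarrow> (real \<Rightarrow> real) \<Rightarrow> (nat \<Rightarrow> real) \<Rightarrow>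
    (nat \<Rightarrow> 'a \<Rightarrow> real) \<Rightarrow> (nat \<Rightarrow> 'a \<Rightarrow> real) \<Rightarrow> nat \<Rightarrow> btree set \<Rightarrow> bool" where
  "admissible M p f w h B n U \<longleftrightarrow>
     U \<noteq> {} \<and> U \<subseteq> trees n \<and>
     (\<forall>T\<in>U. \<forall>S\<in>subtrees T.
        wnorm M p (coeff_H w h S) < \<infinity> \<and> wnorm M p (coeff_B M p f w h B S) < \<infinity>) \<and>
     (\<forall>T\<in>U. \<forall>l r. Merge l r \<in> subtrees T \<longrightarrow>
        0 < (LINT x|M. ((coeff_H w h r x - coeff_H w h l x) / p x)^2 * p x))"

section \<open>The mass-carrying protocol\<close>

definition mix :: "real \<Rightarrow> ('a \<Rightarrow> real) \<Rightarrow> ('a \<Rightarrow> real) \<Rightarrow> 'a \<Rightarrow> real" where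
  "mix t qA qB = (\<lambda>x. (1 - t) * qA x + t * qB x)"

definition balanced :: "'a measure \<Rightarrow> (real \<Rightarrow> real) \<Rightarrow> real \<Rightarrow> real \<Rightarrow>
    ('a \<Rightarrow> real) \<Rightarrow> ('a \<Rightarrow> real) \<Rightarrow> real \<Rightarrow> bool" where
  "balanced M f gA gB qA qB t \<longleftrightarrow>
     gA^2 * fdiv M f qA (mix t qA qB) = gB^2 * fdiv M f qB (mix t qA qB)"

definition local_solution :: "'a measure \<Rightarrow> (real \<Rightarrow> real) \<Rightarrow> real \<Rightarrow> real \<Rightarrow>
    (real \<Rightarrow> 'a \<Rightarrow> real) \<Rightarrow> (real \<Rightarrow> 'a \<Rightarrow> real) \<Rightarrow> (real \<Rightarrow> real) \<Rightarrow> bool" where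
  "local_solution M f gA gB qA qB t \<longleftrightarrow>
     (let \<theta> = gB / (gA + gB) in
      (t \<longlongrightarrow> \<theta>) (at 0) \<and>
      (\<exists>\<eta>>0. \<forall>\<^sub>F \<epsilon> in at 0. t \<epsilon> \<in> {0..1} \<and> t \<epsilon> \<in> ball \<theta> \<eta> \<and>
         (\<forall>s\<in>ball \<theta> \<eta>. balanced M f gA gB (qA \<epsilon>) (qB \<epsilon>) s \<longleftrightarrow> s = t \<epsilon>)))"

text \<open>Local solutions are unique only as germs at \<open>0\<close>, hence the choice operator below. The
  choice affects no statement about the limit \<open>\<epsilon> \<rightarrow> 0\<close>:\<close>

lemma local_solution_unique:
  assumes "local_solution M f gA gB qA qB s" and "local_solution M f gA gB qA qB t"
  shows "\<forall>\<^sub>F \<epsilon> in at 0. s \<epsilon> = t \<epsilon>"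
proof -
  define \<theta> where "\<theta> = gB / (gA + gB)"
  have s: "(s \<longlongrightarrow> \<theta>) (at 0)"
    using assms(1) by (simp add: local_solution_def \<theta>_def Let_def)
  obtain \<eta>' where s': "\<forall>\<^sub>F \<epsilon> in at 0. s \<epsilon> \<in> {0..1} \<and> s \<epsilon> \<in> ball \<theta> \<eta>' \<and>
      (\<forall>r\<in>ball \<theta> \<eta>'. balanced M f gA gB (qA \<epsilon>) (qB \<epsilon>) r \<longleftrightarrow> r = s \<epsilon>)"
    using assms(1) unfolding local_solution_def Let_def \<theta>_def by blast
  obtain \<eta> where \<eta>: "\<eta> > 0"
    and t': "\<forall>\<^sub>F \<epsilon> in at 0. t \<epsilon> \<in> {0..1} \<and> t \<epsilon> \<in> ball \<theta> \<eta> \<and>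
      (\<forall>r\<in>ball \<theta> \<eta>. balanced M f gA gB (qA \<epsilon>) (qB \<epsilon>) r \<longleftrightarrow> r = t \<epsilon>)"
    using assms(2) unfolding local_solution_def Let_def \<theta>_def by blast
  have "\<forall>\<^sub>F \<epsilon> in at 0. s \<epsilon> \<in> ball \<theta> \<eta>"
    using tendstoD[OF s \<eta>] by (simp add: dist_commute)
  with s' t' show ?thesis
    by eventually_elim blast
qed

definition merge_weight :: "'a measure \<Rightarrow> (real \<Rightarrow> real) \<Rightarrow> real \<Rightarrow> real \<Rightarrow>
    (real \<Rightarrow> 'a \<Rightarrow> real) \<Rightarrow> (real \<Rightarrow> 'a \<Rightarrow> real) \<Rightarrow> real \<Rightarrow> real" where
  "merge_weight M f gA gB qA qB = (SOME t. local_solution M f gA gB qA qB t)"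

fun protocol_state :: "'a measure \<Rightarrow> (real \<Rightarrow> real) \<Rightarrow> (nat \<Rightarrow> real) \<Rightarrow>
    (nat \<Rightarrow> real \<Rightarrow> 'a \<Rightarrow> real) \<Rightarrow> btree \<Rightarrow> real \<times> (real \<Rightarrow> 'a \<Rightarrow> real)" where
  "protocol_state M f w P (Leaf i) = (sqrt (w i), P i)"
| "protocol_state M f w P (Merge l r) =
     (let (gA, qA) = protocol_state M f w P l;
          (gB, qB) = protocol_state M f w P r
      in (gA + gB, \<lambda>\<epsilon>. mix (merge_weight M f gA gB qA qB \<epsilon>) (qA \<epsilon>) (qB \<epsilon>)))"

definition root_density :: "'a measure \<Rightarrow> (real \<Rightarrow> real) \<Rightarrow> (nat \<Rightarrow> real) \<Rightarrow>
    (nat \<Rightarrow> real \<Rightarrow> 'a \<Rightarrow> real) \<Rightarrow> btree \<Rightarrow> real \<Rightarrow> 'a \<Rightarrow> real" where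
  "root_density M f w P T = snd (protocol_state M f w P T)"

end

theory Submission
  imports Defs
begin

text \<open>
  A generator satisfies \<open>f (1 + s) = A\<^sub>2 s\<^sup>2 + g s s\<^sup>3\<close> with \<open>g\<close> continuous at \<open>0\<close> and \<open>g 0 = A\<^sub>3\<close>.
  Writing the two inputs of a merge as \<open>q\<^sub>t - t \<epsilon> \<delta> p\<close> and \<open>q\<^sub>t + (1 - t) \<epsilon> \<delta> p\<close> around their mixture
  \<open>q\<^sub>t\<close>, both divergences expand as \<open>\<epsilon>\<^sup>2 (A\<^sub>2 c\<^sup>2 X + \<epsilon> Y)\<close> with \<open>c = - t\<close> or \<open>c = 1 - t\<close> and the same
  \<open>X\<close>, so the balance equation divided by \<open>\<epsilon>\<^sup>2\<close> reads
  \<open>A\<^sub>2 X (G\<^sub>A + G\<^sub>B) (t - \<theta>) (G\<^sub>A t + G\<^sub>B (1 - t)) = \<epsilon> (G\<^sub>B\<^sup>2 Y\<^sub>B - G\<^sub>A\<^sup>2 Y\<^sub>A)\<close>.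
  Hence \<open>(t - \<theta>) / \<epsilon>\<close> tends to \<open>\<tau>\<close>. A locally unique solution exists because each divergence is
  convex in \<open>t\<close> and vanishes at its own endpoint: this gives continuity, and
  \<open>D(s) \<le> (s / t) D(t)\<close> excludes two solutions. The expansion then propagates through the tree,
  and it is uniform because there are only finitely many trees with \<open>n\<close> leaves.
\<close>

section \<open>Essentially uniform limits\<close>

text \<open>Uniform convergence up to null sets, where the null set may depend on \<open>\<epsilon>\<close>.\<close>

definition esslim :: "'a measure \<Rightarrow> (real \<Rightarrow> 'a \<Rightarrow> real) \<Rightarrow> ('a \<Rightarrow> real) \<Rightarrow> bool" where
  "esslim M F g \<longleftrightarrow>
     g \<in> borel_measurable M \<and> (\<exists>K. AE x in M. \<bar>g x\<bar> \<le> K) \<and>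
     (\<forall>\<^sub>F \<epsilon> in at 0. F \<epsilon> \<in> borel_measurable M) \<and>
     (\<forall>e>0. \<forall>\<^sub>F \<epsilon> in at 0. AE x in M. \<bar>F \<epsilon> x - g x\<bar> < e)"

lemma esslimD:
  assumes "esslim M F g"
  shows "g \<in> borel_measurable M" "\<exists>K. AE x in M. \<bar>g x\<bar> \<le> K"
    "\<forall>\<^sub>F \<epsilon> in at 0. F \<epsilon> \<in> borel_measurable M"
    "e > 0 \<Longrightarrow> \<forall>\<^sub>F \<epsilon> in at 0. AE x in M. \<bar>F \<epsilon> x - g x\<bar> < e"
  using assms by (auto simp: esslim_def)

text \<open>A bound for the limit, enlarged by \<open>1\<close>, also bounds the family once the
  error is below \<open>1\<close>; products and integrals need one constant for both.\<close>

lemma esslim_bounded: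
  assumes "esslim M F g"
  obtains K where "K > 0" "AE x in M. \<bar>g x\<bar> \<le> K" "\<forall>\<^sub>F \<epsilon> in at 0. AE x in M. \<bar>F \<epsilon> x\<bar> \<le> K"
proof -
  obtain K where K: "AE x in M. \<bar>g x\<bar> \<le> K"
    using esslimD(2)[OF assms] by blast
  have "\<forall>\<^sub>F \<epsilon> in at 0. AE x in M. \<bar>F \<epsilon> x\<bar> \<le> \<bar>K\<bar> + 1"
    using esslimD(4)[OF assms zero_less_one]
  proof eventually_elim
    case (elim \<epsilon>)
    with K show ?case by eventually_elim linarith
  qed
  moreover have "AE x in M. \<bar>g x\<bar> \<le> \<bar>K\<bar> + 1"
    using K by eventually_elim linarith
  ultimately show ?thesis by (intro that[of "\<bar>K\<bar> + 1"]) auto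
qed

lemma esslim_const:
  assumes "g \<in> borel_measurable M" "AE x in M. \<bar>g x\<bar> \<le> K"
  shows "esslim M (\<lambda>_. g) g"
  using assms by (auto simp: esslim_def)

text \<open>Scalars such as \<open>\<epsilon>\<close> and the mixing weights enter as functions
  constant in \<open>x\<close>, so that the rules for sums and products apply to them.\<close>

lemma esslim_scalar:
  assumes "(c \<longlongrightarrow> c0) (at 0)"
  shows "esslim M (\<lambda>\<epsilon> x. c \<epsilon>) (\<lambda>x. c0)"
  unfolding esslim_def
proof (intro conjI allI impI)
  show "\<exists>K. AE x in M. \<bar>c0\<bar> \<le> K" by (intro exI[of _ "\<bar>c0\<bar>"]) simp
  fix e :: real assume "e > 0"
  from tendstoD[OF assms this] show "\<forall>\<^sub>F \<epsilon> in at 0. AE x in M. \<bar>c \<epsilon> - c0\<bar> < e"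
    by eventually_elim (simp add: dist_real_def)
qed auto

text \<open>Agreement is asked only for small \<open>\<epsilon>\<close> and on the space, because
  identities that divide by \<open>\<epsilon>\<close> or by \<open>p\<close> are available only
  there.\<close>

lemma esslim_cong:
  assumes "esslim M F g" "\<forall>\<^sub>F \<epsilon> in at 0. \<forall>x\<in>space M. F \<epsilon> x = F' \<epsilon> x"
    "\<And>x. x \<in> space M \<Longrightarrow> g x = g' x"
  shows "esslim M F' g'"
  unfolding esslim_def
proof (intro conjI allI impI)
  show "g' \<in> borel_measurable M"
    using esslimD(1)[OF assms(1)] measurable_cong[of M g g' borel] assms(3) by simp
  obtain K where "AE x in M. \<bar>g x\<bar> \<le> K" using esslimD(2)[OF assms(1)] by blast
  then have "AE x in M. \<bar>g' x\<bar> \<le> K" using AE_space by eventually_elim (simp add: assms(3))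
  then show "\<exists>K. AE x in M. \<bar>g' x\<bar> \<le> K" by blast
  show "\<forall>\<^sub>F \<epsilon> in at 0. F' \<epsilon> \<in> borel_measurable M"
    using esslimD(3)[OF assms(1)] assms(2)
  proof eventually_elim
    case (elim \<epsilon>)
    then show ?case using measurable_cong[of M "F \<epsilon>" "F' \<epsilon>" borel] by simp
  qed
  fix e :: real assume "e > 0"
  from esslimD(4)[OF assms(1) this] assms(2)
  show "\<forall>\<^sub>F \<epsilon> in at 0. AE x in M. \<bar>F' \<epsilon> x - g' x\<bar> < e"
  proof eventually_elim
    case (elim \<epsilon>)
    from elim(1) AE_space show ?case
      by eventually_elim (use elim(2) assms(3) in auto)
  qed
qed

lemma esslim_add:
  assumes "esslim M F f" "esslim M G g"
  shows "esslim M (\<lambda>\<epsilon> x. F \<epsilon> x + G \<epsilon> x) (\<lambda>x. f x + g x)"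
  unfolding esslim_def
proof (intro conjI allI impI)
  show "(\<lambda>x. f x + g x) \<in> borel_measurable M"
    using esslimD(1)[OF assms(1)] esslimD(1)[OF assms(2)] by measurable
  obtain K L where "AE x in M. \<bar>f x\<bar> \<le> K" "AE x in M. \<bar>g x\<bar> \<le> L"
    using esslimD(2)[OF assms(1)] esslimD(2)[OF assms(2)] by blast
  then have "AE x in M. \<bar>f x + g x\<bar> \<le> K + L" by eventually_elim linarith
  then show "\<exists>K. AE x in M. \<bar>f x + g x\<bar> \<le> K" by blast
  show "\<forall>\<^sub>F \<epsilon> in at 0. (\<lambda>x. F \<epsilon> x + G \<epsilon> x) \<in> borel_measurable M"
    using esslimD(3)[OF assms(1)] esslimD(3)[OF assms(2)] by eventually_elim measurable
  fix e :: real assume "e > 0"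
  then have "e / 2 > 0" by simp
  from esslimD(4)[OF assms(1) this] esslimD(4)[OF assms(2) this]
  show "\<forall>\<^sub>F \<epsilon> in at 0. AE x in M. \<bar>F \<epsilon> x + G \<epsilon> x - (f x + g x)\<bar> < e"
  proof eventually_elim
    case (elim \<epsilon>)
    then show ?case by eventually_elim (simp add: abs_if split: if_splits)
  qed
qed

lemma esslim_mult:
  assumes "esslim M F f" "esslim M G g"
  shows "esslim M (\<lambda>\<epsilon> x. F \<epsilon> x * G \<epsilon> x) (\<lambda>x. f x * g x)"
  unfolding esslim_def
proof (intro conjI allI impI)
  show "(\<lambda>x. f x * g x) \<in> borel_measurable M"
    using esslimD(1)[OF assms(1)] esslimD(1)[OF assms(2)] by measurable
  obtain K where K: "K > 0" "\<forall>\<^sub>F \<epsilon> in at 0. AE x in M. \<bar>F \<epsilon> x\<bar> \<le> K" "AE x in M. \<bar>f x\<bar> \<le> K"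
    using esslim_bounded[OF assms(1)] by blast
  obtain L where L: "L > 0" "AE x in M. \<bar>g x\<bar> \<le> L"
    using esslim_bounded[OF assms(2)] by blast
  have "AE x in M. \<bar>f x * g x\<bar> \<le> K * L"
    using K(3) L(2) by eventually_elim (simp add: abs_mult mult_mono K(1) L(1) less_imp_le)
  then show "\<exists>K. AE x in M. \<bar>f x * g x\<bar> \<le> K" by blast
  show "\<forall>\<^sub>F \<epsilon> in at 0. (\<lambda>x. F \<epsilon> x * G \<epsilon> x) \<in> borel_measurable M"
    using esslimD(3)[OF assms(1)] esslimD(3)[OF assms(2)] by eventually_elim measurable
  fix e :: real assume e: "e > 0"
  \<comment> \<open>Chosen so that \<open>K * b\<close> and \<open>a * L\<close> are each half of
    \<open>e\<close>.\<close>
  define a b where "a = e / (2 * L)" and "b = e / (2 * K)"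
  have ab: "a > 0" "b > 0" using e K(1) L(1) by (auto simp: a_def b_def)
  from esslimD(4)[OF assms(1) ab(1)] esslimD(4)[OF assms(2) ab(2)] K(2)
  show "\<forall>\<^sub>F \<epsilon> in at 0. AE x in M. \<bar>F \<epsilon> x * G \<epsilon> x - f x * g x\<bar> < e"
  proof eventually_elim
    case (elim \<epsilon>)
    from elim L(2) show ?case
    proof eventually_elim
      case (elim x)
      have "F \<epsilon> x * G \<epsilon> x - f x * g x = F \<epsilon> x * (G \<epsilon> x - g x) + (F \<epsilon> x - f x) * g x"
        by algebra
      then have "\<bar>F \<epsilon> x * G \<epsilon> x - f x * g x\<bar>
          \<le> \<bar>F \<epsilon> x\<bar> * \<bar>G \<epsilon> x - g x\<bar> + \<bar>F \<epsilon> x - f x\<bar> * \<bar>g x\<bar>"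
        by (metis abs_mult abs_triangle_ineq)
      also have "\<dots> \<le> K * \<bar>G \<epsilon> x - g x\<bar> + \<bar>F \<epsilon> x - f x\<bar> * L"
        using elim by (intro add_mono mult_right_mono mult_left_mono) auto
      also have "\<dots> < K * b + a * L"
        using elim K(1) L(1) by (intro add_strict_mono mult_strict_left_mono mult_strict_right_mono) auto
      also have "\<dots> = e" using K(1) L(1) by (simp add: a_def b_def field_simps)
      finally show ?case .
    qed
  qed
qed

lemma esslim_diff:
  assumes "esslim M F f" "esslim M G g"
  shows "esslim M (\<lambda>\<epsilon> x. F \<epsilon> x - G \<epsilon> x) (\<lambda>x. f x - g x)"
  using esslim_add[OF assms(1) esslim_mult[OF esslim_scalar[OF tendsto_const[of "-1"]] assms(2)]]
  by simp

text \<open>The limit is a single constant, so continuity of \<open>\<phi>\<close> at that one point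
  turns a uniformly small error of the argument into a uniformly small error of the value.\<close>

lemma esslim_compose:
  assumes "esslim M F (\<lambda>_. c)" "\<phi> \<in> borel_measurable borel" "isCont \<phi> c"
  shows "esslim M (\<lambda>\<epsilon> x. \<phi> (F \<epsilon> x)) (\<lambda>_. \<phi> c)"
  unfolding esslim_def
proof (intro conjI allI impI)
  show "\<exists>K. AE x in M. \<bar>\<phi> c\<bar> \<le> K" by (intro exI[of _ "\<bar>\<phi> c\<bar>"]) simp
  show "\<forall>\<^sub>F \<epsilon> in at 0. (\<lambda>x. \<phi> (F \<epsilon> x)) \<in> borel_measurable M"
    using esslimD(3)[OF assms(1)] by eventually_elim (rule measurable_compose[OF _ assms(2)])
  fix e :: real assume "e > 0"
  then obtain d where d: "d > 0" "\<And>y. \<bar>y - c\<bar> < d \<Longrightarrow> \<bar>\<phi> y - \<phi> c\<bar> < e"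
    using assms(3) unfolding continuous_at_eps_delta dist_real_def by blast
  from esslimD(4)[OF assms(1) d(1)]
  show "\<forall>\<^sub>F \<epsilon> in at 0. AE x in M. \<bar>\<phi> (F \<epsilon> x) - \<phi> c\<bar> < e"
  proof eventually_elim
    case (elim \<epsilon>)
    then show ?case by eventually_elim (rule d(2))
  qed
qed simp

section \<open>Integrals of essentially uniform limits against \<open>p\<close>\<close>

lemma integrable_bounded_mult:
  fixes p g :: "'a \<Rightarrow> real"
  assumes "integrable M p" "g \<in> borel_measurable M" "AE x in M. \<bar>g x\<bar> \<le> K"
  shows "integrable M (\<lambda>x. g x * p x)"
proof (rule Bochner_Integration.integrable_bound)
  show "integrable M (\<lambda>x. K * p x)" using assms(1) by simp
  show "(\<lambda>x. g x * p x) \<in> borel_measurable M" using assms by measurable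
  show "AE x in M. norm (g x * p x) \<le> norm (K * p x)"
    using assms(3) by eventually_elim (auto simp: abs_mult intro!: mult_right_mono)
qed

lemma esslim_integrable:
  assumes "esslim M F g" "integrable M p"
  shows "\<forall>\<^sub>F \<epsilon> in at 0. integrable M (\<lambda>x. F \<epsilon> x * p x)"
proof -
  obtain K where "\<forall>\<^sub>F \<epsilon> in at 0. AE x in M. \<bar>F \<epsilon> x\<bar> \<le> K"
    using esslim_bounded[OF assms(1)] by blast
  with esslimD(3)[OF assms(1)] show ?thesis
    by eventually_elim (rule integrable_bounded_mult[OF assms(2)])
qed

text \<open>An error below \<open>d\<close> almost everywhere changes the integral by at most
  \<open>d\<close> times the mass of \<open>p\<close>.\<close>

lemma esslim_integral:
  assumes "esslim M F g" "integrable M p" "\<And>x. x \<in> space M \<Longrightarrow> 0 \<le> p x"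
  shows "((\<lambda>\<epsilon>. LINT x|M. F \<epsilon> x * p x) \<longlongrightarrow> (LINT x|M. g x * p x)) (at 0)"
proof (rule tendstoI)
  fix e :: real assume e: "e > 0"
  define I where "I = (LINT x|M. p x)"
  have I: "I \<ge> 0" unfolding I_def using assms(3) by (intro integral_nonneg_AE) simp
  \<comment> \<open>Dividing by \<open>I + 1\<close> covers \<open>I = 0\<close> and leaves room for
    the strict inequality at the end.\<close>
  define d where "d = e / (I + 1)"
  have d: "d > 0" using e I by (simp add: d_def)
  have "esslim M (\<lambda>_. g) g" using esslimD(1,2)[OF assms(1)] esslim_const by blast
  then have g: "integrable M (\<lambda>x. g x * p x)"
    using esslim_integrable[OF _ assms(2)] by fastforce
  from esslimD(4)[OF assms(1) d] esslim_integrable[OF assms(1,2)]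
  show "\<forall>\<^sub>F \<epsilon> in at 0. dist (LINT x|M. F \<epsilon> x * p x) (LINT x|M. g x * p x) < e"
  proof eventually_elim
    case (elim \<epsilon>)
    have "\<bar>(LINT x|M. F \<epsilon> x * p x) - (LINT x|M. g x * p x)\<bar>
        = \<bar>LINT x|M. F \<epsilon> x * p x - g x * p x\<bar>"
      using elim(2) g by simp
    also have "\<dots> \<le> (LINT x|M. \<bar>F \<epsilon> x * p x - g x * p x\<bar>)"
      by (rule integral_abs_bound)
    also have "\<dots> \<le> (LINT x|M. d * p x)"
    proof (rule integral_mono_AE)
      show "AE x in M. \<bar>F \<epsilon> x * p x - g x * p x\<bar> \<le> d * p x"
        using elim(1) AE_space
      proof eventually_elim
        case (elim x)
        have "\<bar>F \<epsilon> x * p x - g x * p x\<bar> = \<bar>F \<epsilon> x - g x\<bar> * p x"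
          using assms(3)[OF elim(2)] by (simp add: abs_mult left_diff_distrib[symmetric])
        also have "\<dots> \<le> d * p x"
          using assms(3)[OF elim(2)] elim(1) by (intro mult_right_mono) auto
        finally show ?case .
      qed
    qed (use elim(2) g assms(2) in auto)
    also have "\<dots> = d * I" by (simp add: I_def)
    also have "\<dots> < d * (I + 1)" using d by simp
    also have "\<dots> = e" using I by (simp add: d_def)
    finally show ?case by (simp add: dist_real_def)
  qed
qed

section \<open>Convexity of the divergence\<close>

locale perturbation =
  fixes M :: "'a measure" and p :: "'a \<Rightarrow> real" and f :: "real \<Rightarrow> real"
  assumes p_density: "prob_density M p"
    and p_pos: "x \<in> space M \<Longrightarrow> 0 < p x"
    and f_generator: "generator f"
begin

lemma p_measurable [measurable]: "p \<in> borel_measurable M"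
  and p_integrable: "integrable M p"
  using p_density by (auto simp: prob_density_def)

lemma f_convex: "convex_on {0<..} f" and f_one: "f 1 = 0"
  and A2_pos: "coeff_A2 f > 0"
  using f_generator by (auto simp: generator_def coeff_A2_def)

lemma f_continuous: "continuous_on {0<..} f"
  using convex_on_continuous[OF _ f_convex] by simp

text \<open>The values of \<open>f\<close> on the negative reals are unconstrained, possibly non-measurable.\<close>

definition fpos :: "real \<Rightarrow> real" where
  "fpos t = (if 0 < t then f t else f 0)"

lemma fpos_eq: "0 \<le> t \<Longrightarrow> fpos t = f t"
  by (auto simp: fpos_def)

text \<open>Convexity makes \<open>f\<close> continuous on the open half-line, and
  \<open>fpos\<close> is constant on the rest.\<close>

lemma fpos_measurable [measurable]: "fpos \<in> borel_measurable borel"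
proof -
  have "(\<lambda>t. indicator {0<..} t *\<^sub>R f t + indicator {..0} t *\<^sub>R f 0) \<in> borel_measurable borel"
    using borel_measurable_continuous_on_indicator[OF _ f_continuous] by measurable
  moreover have "(\<lambda>t. indicator {0<..} t *\<^sub>R f t + indicator {..0} t *\<^sub>R f 0) = fpos"
    by (auto simp: fpos_def fun_eq_iff)
  ultimately show ?thesis by simp
qed

section \<open>Cubic Taylor remainder of the generator\<close>

text \<open>This is the function \<open>g\<close> of the opening remark; the value at
  \<open>0\<close> is the one that makes it continuous there.\<close>

definition taylor_quot :: "real \<Rightarrow> real" where
  "taylor_quot s = (if s = 0 then coeff_A3 f else (fpos (1 + s) - coeff_A2 f * s^2) / s^3)"

text \<open>An identity for every \<open>s\<close>, with the whole error inside
  \<open>taylor_quot\<close>, so it can be substituted under an integral without first restricting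
  to small \<open>s\<close>.\<close>

lemma fpos_taylor: "fpos (1 + s) = coeff_A2 f * s^2 + taylor_quot s * s^3"
  using f_one by (simp add: taylor_quot_def fpos_def)

lemma taylor_quot_measurable [measurable]: "taylor_quot \<in> borel_measurable borel"
  unfolding taylor_quot_def[abs_def] by measurable

text \<open>By the Lagrange form of the remainder, the quotient at a small
  \<open>s \<noteq> 0\<close> is one sixth of the third derivative at a point between
  \<open>1\<close> and \<open>1 + s\<close>.\<close>

lemma isCont_taylor_quot: "isCont taylor_quot 0"
proof -
  obtain d where d: "d > 0"
    and diff: "\<And>k x. k < 3 \<Longrightarrow> x \<in> ball 1 d \<Longrightarrow> (deriv ^^ k) f field_differentiable (at x)"
    and cont: "continuous_on (ball 1 d) ((deriv ^^ 3) f)"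
    using f_generator by (auto simp: generator_def)
  have D1: "deriv f 1 = 0" using f_generator by (simp add: generator_def)
  have "isCont ((deriv ^^ 3) f) 1"
    using cont d by (simp add: continuous_on_eq_continuous_at)
  show ?thesis
    unfolding continuous_at_eps_delta dist_real_def
  proof (intro allI impI)
    fix e :: real assume e: "e > 0"
    \<comment> \<open>The factor \<open>6\<close> offsets the \<open>fact 3\<close> in the
      remainder.\<close>
    then obtain c where c: "c > 0" "\<And>y. \<bar>y - 1\<bar> < c \<Longrightarrow> \<bar>(deriv ^^ 3) f y - (deriv ^^ 3) f 1\<bar> < 6 * e"
      using \<open>isCont ((deriv ^^ 3) f) 1\<close>[unfolded continuous_at_eps_delta dist_real_def, rule_format, of "6 * e"]
      by auto
    \<comment> \<open>\<open>d / 2\<close> keeps the closed interval around \<open>1\<close> inside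
      the ball of differentiability, \<open>c\<close> is the modulus of continuity just obtained,
      and \<open>1 / 2\<close> keeps \<open>1 + s\<close> positive, where \<open>fpos\<close> is
      \<open>f\<close>.\<close>
    define b where "b = min (min (d / 2) c) (1 / 2)"
    have b: "b > 0" "b < d" "b \<le> c" "b < 1" using d c(1) by (auto simp: b_def)
    have "\<bar>taylor_quot s - taylor_quot 0\<bar> < e" if s: "\<bar>s - 0\<bar> < b" for s
    proof (cases "s = 0")
      case False
      have "\<exists>t. (if 1 + s < 1 then 1 + s < t \<and> t < 1 else 1 < t \<and> t < 1 + s) \<and>
          f (1 + s) = (\<Sum>m<3. ((deriv ^^ m) f 1 / fact m) * (1 + s - 1)^m)
            + ((deriv ^^ 3) f t / fact 3) * (1 + s - 1)^3"
      proof (rule Taylor[of 3 "\<lambda>m. (deriv ^^ m) f" f "1 - b" "1 + b"])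
        show "\<forall>m t. m < 3 \<and> 1 - b \<le> t \<and> t \<le> 1 + b \<longrightarrow>
            ((deriv ^^ m) f has_real_derivative (deriv ^^ Suc m) f t) (at t)"
        proof (intro allI impI)
          fix m :: nat and t :: real assume m: "m < 3 \<and> 1 - b \<le> t \<and> t \<le> 1 + b"
          then have "t \<in> ball 1 d" using b by (auto simp: dist_real_def)
          then show "((deriv ^^ m) f has_real_derivative (deriv ^^ Suc m) f t) (at t)"
            using diff[of m t] m by (simp add: field_differentiable_derivI)
        qed
      qed (use s b False in auto)
      \<comment> \<open>The cases left and right of \<open>1\<close> matter only through the
        distance of \<open>t\<close> from \<open>1\<close>.\<close>
      then have "\<exists>t. \<bar>t - 1\<bar> < \<bar>s\<bar> \<and>
          f (1 + s) = (\<Sum>m<3. ((deriv ^^ m) f 1 / fact m) * s^m) + ((deriv ^^ 3) f t / fact 3) * s^3"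
        by (elim ex_forward) (simp split: if_splits)
      then obtain t where t: "\<bar>t - 1\<bar> < \<bar>s\<bar>"
        and ft: "f (1 + s) = (\<Sum>m<3. ((deriv ^^ m) f 1 / fact m) * s^m) + ((deriv ^^ 3) f t / fact 3) * s^3"
        by blast
      have "f (1 + s) = coeff_A2 f * s^2 + (deriv ^^ 3) f t / 6 * s^3"
        unfolding ft using f_one D1
        by (simp add: numeral_3_eq_3 lessThan_Suc coeff_A2_def numeral_2_eq_2)
      moreover have "fpos (1 + s) = f (1 + s)" using s b by (simp add: fpos_eq)
      ultimately have "taylor_quot s = (deriv ^^ 3) f t / 6"
        using False by (simp add: taylor_quot_def)
      moreover have "\<bar>(deriv ^^ 3) f t - (deriv ^^ 3) f 1\<bar> < 6 * e"
        using t s b by (intro c(2)) auto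
      ultimately show ?thesis
        by (simp add: taylor_quot_def coeff_A3_def flip: diff_divide_distrib)
    qed (use e in auto)
    then show "\<exists>b>0. \<forall>s. \<bar>s - 0\<bar> < b \<longrightarrow> \<bar>taylor_quot s - taylor_quot 0\<bar> < e"
      using b(1) by blast
  qed
qed

section \<open>Densities comparable to \<open>p\<close>\<close>

text \<open>Two such densities have a ratio in \<open>[1/4, 4]\<close> almost everywhere, a compact
  part of the domain of \<open>f\<close>. Nonnegativity is kept at every point of the space, so that
  \<open>f\<close> and \<open>fpos\<close> agree on the ratios there.\<close>

definition near :: "('a \<Rightarrow> real) \<Rightarrow> bool" where
  "near q \<longleftrightarrow> q \<in> borel_measurable M \<and> (\<forall>x\<in>space M. 0 \<le> q x) \<and>
     (AE x in M. p x / 2 \<le> q x \<and> q x \<le> 2 * p x)"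

lemma near_mix:
  assumes "near q" "near r" "t \<in> {0..1}"
  shows "near (mix t q r)"
  unfolding near_def mix_def
proof (intro conjI ballI)
  show "(\<lambda>x. (1 - t) * q x + t * r x) \<in> borel_measurable M"
    using assms by (auto simp: near_def)
  show "0 \<le> (1 - t) * q x + t * r x" if "x \<in> space M" for x
    using assms that by (auto simp: near_def)
  have "AE x in M. p x / 2 \<le> q x \<and> q x \<le> 2 * p x" "AE x in M. p x / 2 \<le> r x \<and> r x \<le> 2 * p x"
    using assms by (auto simp: near_def)
  then show "AE x in M. p x / 2 \<le> (1 - t) * q x + t * r x \<and> (1 - t) * q x + t * r x \<le> 2 * p x"
  proof eventually_elim
    case (elim x)
    have "(1 - t) * (p x / 2) + t * (p x / 2) \<le> (1 - t) * q x + t * r x"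
      "(1 - t) * q x + t * r x \<le> (1 - t) * (2 * p x) + t * (2 * p x)"
      by (intro add_mono mult_left_mono; use assms(3) elim in auto)+
    moreover have c: "(1 - t) * c + t * c = c" for c :: real
      by (simp add: algebra_simps)
    ultimately show ?case unfolding c by blast
  qed
qed

text \<open>\<open>f\<close> is bounded on the compact range of the ratio, so the integrand is at
  most a constant times \<open>p\<close>; measurability comes through \<open>fpos\<close>.\<close>

lemma near_integrable:
  assumes "near r" "near q"
  shows "integrable M (\<lambda>x. q x * f (r x / q x))"
proof -
  have [measurable]: "q \<in> borel_measurable M" "r \<in> borel_measurable M"
    using assms by (auto simp: near_def)
  have "bounded (f ` {1/4..4})"
    by (intro compact_imp_bounded compact_continuous_image continuous_on_subset[OF f_continuous]) auto
  then obtain C where C: "\<And>t. t \<in> {1/4..4} \<Longrightarrow> \<bar>f t\<bar> \<le> C"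
    unfolding bounded_iff by (metis imageI real_norm_def)
  have "AE x in M. p x / 2 \<le> q x \<and> q x \<le> 2 * p x" "AE x in M. p x / 2 \<le> r x \<and> r x \<le> 2 * p x"
    using assms by (auto simp: near_def)
  then have "AE x in M. \<bar>q x / p x * fpos (r x / q x)\<bar> \<le> 2 * C"
    using AE_space
  proof eventually_elim
    case (elim x)
    note p = p_pos[OF elim(3)]
    have q: "q x > 0" "r x > 0" using elim p by auto
    have "r x / q x \<in> {1/4..4}" using elim q by (auto simp: field_simps)
    then have "\<bar>fpos (r x / q x)\<bar> \<le> C" using C[of "r x / q x"] fpos_eq[of "r x / q x"] q by simp
    moreover have "\<bar>q x / p x\<bar> \<le> 2" using elim p q by (auto simp: field_simps)
    ultimately show ?case unfolding abs_mult by (intro mult_mono) auto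
  qed
  then have "integrable M (\<lambda>x. (q x / p x * fpos (r x / q x)) * p x)"
    by (intro integrable_bounded_mult p_integrable) measurable
  moreover have "(q x / p x * fpos (r x / q x)) * p x = q x * f (r x / q x)" if "x \<in> space M" for x
    using p_pos[OF that] assms that fpos_eq[of "r x / q x"] by (auto simp: near_def)
  ultimately show ?thesis
    by (subst Bochner_Integration.integrable_cong[OF refl]) auto
qed

text \<open>The perspective \<open>q \<mapsto> q f(r/q)\<close> of a convex function is convex.\<close>

lemma fdiv_convex:
  assumes "near r" "near q1" "near q2" "t \<in> {0..1}"
  shows "fdiv M f r (mix t q1 q2) \<le> (1 - t) * fdiv M f r q1 + t * fdiv M f r q2"
proof -
  let ?q = "mix t q1 q2"
  note q = near_mix[OF assms(2-4)]
  note int = near_integrable[OF assms(1) q] near_integrable[OF assms(1,2)] near_integrable[OF assms(1,3)]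
  have "AE x in M. p x / 2 \<le> r x" "AE x in M. p x / 2 \<le> ?q x"
    "AE x in M. p x / 2 \<le> q1 x" "AE x in M. p x / 2 \<le> q2 x"
    using assms q by (auto simp: near_def)
  then have "AE x in M. ?q x * f (r x / ?q x) \<le>
      (1 - t) * (q1 x * f (r x / q1 x)) + t * (q2 x * f (r x / q2 x))"
    using AE_space
  proof eventually_elim
    case (elim x)
    have pos: "0 < r x" "0 < ?q x" "0 < q1 x" "0 < q2 x"
      using elim p_pos[OF elim(5)] by auto
    \<comment> \<open>\<open>\<mu>\<close> is the share of \<open>q2\<close> in the mixture at
      \<open>x\<close>; with it the convex combination of \<open>r / q1\<close> and
      \<open>r / q2\<close> is exactly \<open>r / ?q\<close>.\<close>
    define \<mu> where "\<mu> = t * q2 x / ?q x"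
    have q: "?q x = (1 - t) * q1 x + t * q2 x" by (simp add: mix_def)
    have \<mu>: "1 - \<mu> = (1 - t) * q1 x / ?q x"
      using pos(2) by (simp add: \<mu>_def field_simps) (simp add: q algebra_simps)
    have "1 - \<mu> \<ge> 0" "\<mu> \<ge> 0"
      using pos assms(4) by (auto simp: \<mu>) (auto simp: \<mu>_def)
    then have "f ((1 - \<mu>) *\<^sub>R (r x / q1 x) + \<mu> *\<^sub>R (r x / q2 x))
        \<le> (1 - \<mu>) * f (r x / q1 x) + \<mu> * f (r x / q2 x)"
      using pos by (intro convex_onD[OF f_convex]) auto
    moreover have "(1 - \<mu>) *\<^sub>R (r x / q1 x) + \<mu> *\<^sub>R (r x / q2 x) = r x / ?q x"
      using pos by (simp add: \<mu>) (simp add: \<mu>_def flip: add_divide_distrib distrib_right)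
    ultimately have "?q x * f (r x / ?q x) \<le> ?q x * ((1 - \<mu>) * f (r x / q1 x) + \<mu> * f (r x / q2 x))"
      using pos by (intro mult_left_mono) auto
    also have "\<dots> = (1 - t) * (q1 x * f (r x / q1 x)) + t * (q2 x * f (r x / q2 x))"
      using pos by (simp add: \<mu> distrib_left) (simp add: \<mu>_def)
    finally show ?case .
  qed
  then have "fdiv M f r ?q \<le> (LINT x|M. (1 - t) * (q1 x * f (r x / q1 x)) + t * (q2 x * f (r x / q2 x)))"
    unfolding fdiv_def using int by (intro integral_mono_AE) auto
  also have "\<dots> = (1 - t) * fdiv M f r q1 + t * fdiv M f r q2"
    unfolding fdiv_def using int by simp
  finally show ?thesis .
qed

lemma fdiv_self:
  assumes "near q"
  shows "fdiv M f q q = 0"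
proof -
  have "AE x in M. p x / 2 \<le> q x" using assms by (auto simp: near_def)
  then have "AE x in M. q x * f (q x / q x) = 0"
    using AE_space
  proof eventually_elim
    case (elim x)
    then show ?case using p_pos[OF elim(2)] f_one by simp
  qed
  then show ?thesis unfolding fdiv_def by (rule integral_eq_zero_AE)
qed

section \<open>Divergence along a segment of mixtures, and uniqueness of the balanced weight\<close>

lemma mix_mix: "mix t (mix a q r) (mix b q r) = mix ((1 - t) * a + t * b) q r"
  by (auto simp: mix_def fun_eq_iff algebra_simps)

lemma mix_simps [simp]: "mix 0 q r = q" "mix 1 q r = r"
  by (auto simp: mix_def)

text \<open>Its use is continuity in the weight, which convexity supplies in the interior of the
  interval.\<close>

lemma fdiv_mix_convex:
  assumes "near s" "near q" "near r"
  shows "convex_on {0..1} (\<lambda>t. fdiv M f s (mix t q r))"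
proof (rule convex_onI)
  fix t x y :: real assume "0 < t" "t < 1" "x \<in> {0..1}" "y \<in> {0..1}"
  then show "fdiv M f s (mix ((1 - t) *\<^sub>R x + t *\<^sub>R y) q r)
      \<le> (1 - t) * fdiv M f s (mix x q r) + t * fdiv M f s (mix y q r)"
    using fdiv_convex[OF assms(1) near_mix[OF assms(2,3), of x] near_mix[OF assms(2,3), of y], of t]
    by (simp add: mix_mix)
qed auto

text \<open>Convexity along the chord from the endpoint \<open>q\<close>, where the divergence of
  \<open>q\<close> vanishes, to the mixture of weight \<open>t\<close>.\<close>

lemma fdiv_mix_left:
  assumes "near q" "near r" "0 \<le> s" "s \<le> t" "0 < t" "t \<le> 1"
  shows "fdiv M f q (mix s q r) \<le> s / t * fdiv M f q (mix t q r)"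
  using fdiv_convex[OF assms(1,1) near_mix[OF assms(1,2), of t], of "s / t"] assms
    fdiv_self[OF assms(1)] mix_mix[of "s / t" 0 q r t]
  by (simp add: field_simps)

text \<open>The mirror image of \<open>fdiv_mix_left\<close>, with the roles of the endpoints
  exchanged.\<close>

lemma fdiv_mix_right:
  assumes "near q" "near r" "0 \<le> s" "s \<le> t" "s < 1" "t \<le> 1"
  shows "fdiv M f r (mix t q r) \<le> (1 - t) / (1 - s) * fdiv M f r (mix s q r)"
proof -
  have flip: "mix a q r = mix (1 - a) r q" for a by (auto simp: mix_def fun_eq_iff)
  show ?thesis
    using fdiv_mix_left[OF assms(2,1), of "1 - t" "1 - s"] assms(3-) by (simp flip: flip)
qed

text \<open>If \<open>s < t\<close>, then from \<open>s\<close> to \<open>t\<close> the divergence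
  of \<open>qA\<close> grows at least by the factor \<open>t / s\<close>, while that of
  \<open>qB\<close> shrinks at least by \<open>(1 - t) / (1 - s)\<close>. Both weights can be
  balanced only if the divergences vanish, which positivity at \<open>c\<close> excludes.\<close>

lemma balanced_unique:
  assumes "near qA" "near qB" "gA > 0" "0 < c" "t < 1" "c \<le> s" "s \<le> t"
    and "fdiv M f qA (mix c qA qB) > 0"
    and "balanced M f gA gB qA qB s" "balanced M f gA gB qA qB t"
  shows "s = t"
proof (rule ccontr)
  assume "s \<noteq> t"
  with assms have st: "s < t" "0 < s" "0 < t" "s < 1" by auto
  let ?A = "\<lambda>u. fdiv M f qA (mix u qA qB)" and ?B = "\<lambda>u. fdiv M f qB (mix u qA qB)"
  \<comment> \<open>Positivity at the left anchor \<open>c\<close> propagates to the larger weight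
    \<open>t\<close>.\<close>
  have "0 < ?A c" by fact
  also have "?A c \<le> c / t * ?A t" using assms st by (intro fdiv_mix_left) auto
  finally have At: "0 < ?A t" using assms st by (simp add: zero_less_mult_iff zero_less_divide_iff)
  define \<rho> where "\<rho> = (1 - t) / (1 - s)"
  have \<rho>: "0 < \<rho>" "\<rho> < 1" using assms st by (auto simp: \<rho>_def)
  have "gA^2 * ?A t = gB^2 * ?B t" using assms(10) by (simp add: balanced_def)
  also have "\<dots> \<le> gB^2 * (\<rho> * ?B s)"
    unfolding \<rho>_def using assms st by (intro mult_left_mono fdiv_mix_right) auto
  also have "\<dots> = \<rho> * (gA^2 * ?A s)" using assms(9) by (simp add: balanced_def)
  also have "\<dots> \<le> \<rho> * (gA^2 * (s / t * ?A t))"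
    using assms st \<rho> by (intro mult_left_mono fdiv_mix_left) auto
  also have "\<dots> = (\<rho> * (s / t)) * (gA^2 * ?A t)" by simp
  also have "\<dots> < 1 * (gA^2 * ?A t)"
  proof (rule mult_strict_right_mono)
    have "\<rho> * (s / t) < 1 * 1" using \<rho> st by (intro mult_strict_mono) auto
    then show "\<rho> * (s / t) < 1" by simp
    show "0 < gA^2 * ?A t" using At assms by simp
  qed
  finally show False by simp
qed

section \<open>Expansion of the divergence\<close>

text \<open>\<open>u\<close> is the first-order coefficient of \<open>q \<epsilon> / p\<close>
  around \<open>1\<close>. The sign condition is pointwise because ratios must stay where
  \<open>f\<close> and \<open>fpos\<close> agree.\<close>

definition first_order :: "(real \<Rightarrow> 'a \<Rightarrow> real) \<Rightarrow> ('a \<Rightarrow> real) \<Rightarrow> bool" where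
  "first_order q u \<longleftrightarrow> (\<forall>\<^sub>F \<epsilon> in at 0. \<forall>x\<in>space M. 0 \<le> q \<epsilon> x) \<and>
     esslim M (\<lambda>\<epsilon> x. (q \<epsilon> x / p x - 1) / \<epsilon>) u"

lemma first_order_ratio:
  assumes "first_order q u"
  shows "esslim M (\<lambda>\<epsilon> x. q \<epsilon> x / p x) (\<lambda>_. 1)"
proof -
  have "esslim M (\<lambda>\<epsilon> x. 1 + \<epsilon> * ((q \<epsilon> x / p x - 1) / \<epsilon>)) (\<lambda>x. 1 + 0 * u x)"
    using assms unfolding first_order_def
    by (intro esslim_add esslim_mult esslim_scalar tendsto_intros) auto
  then show ?thesis
    by (rule esslim_cong) (auto simp: eventually_at_filter)
qed

lemma first_order_near:
  assumes "first_order q u"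
  shows "\<forall>\<^sub>F \<epsilon> in at 0. near (q \<epsilon>)"
proof -
  note r = first_order_ratio[OF assms]
  have "\<forall>\<^sub>F \<epsilon> in at 0. \<forall>x\<in>space M. 0 \<le> q \<epsilon> x"
    using assms by (simp add: first_order_def)
  with esslimD(3)[OF r] esslimD(4)[OF r, of "1 / 2", simplified]
  show ?thesis
  proof eventually_elim
    case (elim \<epsilon>)
    \<comment> \<open>Measurability is known for the ratio; multiplying back by the positive
      \<open>p\<close> recovers it for the density.\<close>
    have "(\<lambda>x. q \<epsilon> x / p x * p x) \<in> borel_measurable M" using elim(1) by measurable
    moreover have "q \<epsilon> x / p x * p x = q \<epsilon> x" if "x \<in> space M" for x
      using p_pos[OF that] by simp
    ultimately have "q \<epsilon> \<in> borel_measurable M"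
      using measurable_cong[of M "\<lambda>x. q \<epsilon> x / p x * p x" "q \<epsilon>" borel] by simp
    moreover have "AE x in M. p x / 2 \<le> q \<epsilon> x \<and> q \<epsilon> x \<le> 2 * p x"
      using elim(2) AE_space
    proof eventually_elim
      case (elim x)
      define a where "a = q \<epsilon> x / p x"
      have q: "q \<epsilon> x = a * p x" using p_pos[OF elim(2)] by (simp add: a_def)
      have "\<bar>a - 1\<bar> < 1 / 2" using elim(1) by (simp add: a_def)
      then have "1 / 2 \<le> a" "a \<le> 2" by linarith+
      then have "1 / 2 * p x \<le> a * p x" "a * p x \<le> 2 * p x"
        using p_pos[OF elim(2)] by (intro mult_right_mono; simp)+
      then show ?case by (simp add: q)
    qed
    ultimately show ?case using elim(3) by (simp add: near_def)
  qed
qed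

text \<open>The weights sum to one, so the base density cancels. The error of the weight multiplies
  deviations already of order \<open>\<epsilon>\<close>, hence mere convergence to \<open>s0\<close>
  is enough.\<close>

lemma first_order_mix:
  assumes "first_order qA u" "first_order qB v" "(s \<longlongrightarrow> s0) (at 0)" "\<forall>\<^sub>F \<epsilon> in at 0. s \<epsilon> \<in> {0..1}"
  shows "first_order (\<lambda>\<epsilon>. mix (s \<epsilon>) (qA \<epsilon>) (qB \<epsilon>)) (\<lambda>x. (1 - s0) * u x + s0 * v x)"
  unfolding first_order_def
proof
  have "\<forall>\<^sub>F \<epsilon> in at 0. \<forall>x\<in>space M. 0 \<le> qA \<epsilon> x" "\<forall>\<^sub>F \<epsilon> in at 0. \<forall>x\<in>space M. 0 \<le> qB \<epsilon> x"
    using assms by (auto simp: first_order_def)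
  then show "\<forall>\<^sub>F \<epsilon> in at 0. \<forall>x\<in>space M. 0 \<le> mix (s \<epsilon>) (qA \<epsilon>) (qB \<epsilon>) x"
    using assms(4) by eventually_elim (auto simp: mix_def)
  have "esslim M (\<lambda>\<epsilon> x. (1 - s \<epsilon>) * ((qA \<epsilon> x / p x - 1) / \<epsilon>) + s \<epsilon> * ((qB \<epsilon> x / p x - 1) / \<epsilon>))
      (\<lambda>x. (1 - s0) * u x + s0 * v x)"
    using assms unfolding first_order_def
    by (intro esslim_add esslim_mult esslim_scalar tendsto_intros) auto
  then show "esslim M (\<lambda>\<epsilon> x. (mix (s \<epsilon>) (qA \<epsilon>) (qB \<epsilon>) x / p x - 1) / \<epsilon>) (\<lambda>x. (1 - s0) * u x + s0 * v x)"
  proof (rule esslim_cong)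
    show "\<forall>\<^sub>F \<epsilon> in at 0. \<forall>x\<in>space M. (1 - s \<epsilon>) * ((qA \<epsilon> x / p x - 1) / \<epsilon>) + s \<epsilon> * ((qB \<epsilon> x / p x - 1) / \<epsilon>)
        = (mix (s \<epsilon>) (qA \<epsilon>) (qB \<epsilon>) x / p x - 1) / \<epsilon>"
      by (auto simp: mix_def diff_divide_distrib add_divide_distrib algebra_simps)
  qed simp
qed

text \<open>The ratio \<open>r / q\<close> is \<open>1 + S\<close> with
  \<open>S = \<epsilon> c D / Q\<close> uniformly small, so the Taylor identity gives an exact
  two-term formula. The quadratic integral does not involve \<open>c\<close> and is kept unexpanded:
  both inputs of a merge then share it, and its own rate of convergence never enters.\<close>

lemma fdiv_expansion:
  assumes D: "esslim M D \<Delta>" and Q: "esslim M Q (\<lambda>_. 1)" and c: "(c \<longlongrightarrow> c0) (at 0)"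
    and qr: "\<forall>\<^sub>F \<epsilon> in at 0. \<forall>x\<in>space M. 0 \<le> q \<epsilon> x \<and> 0 \<le> r \<epsilon> x \<and>
      q \<epsilon> x = Q \<epsilon> x * p x \<and> r \<epsilon> x = (Q \<epsilon> x + \<epsilon> * c \<epsilon> * D \<epsilon> x) * p x"
  shows "\<exists>Y. (Y \<longlongrightarrow> coeff_A3 f * c0^3 * (LINT x|M. \<Delta> x^3 * p x)) (at 0) \<and>
    (\<forall>\<^sub>F \<epsilon> in at 0. fdiv M f (r \<epsilon>) (q \<epsilon>) =
       \<epsilon>^2 * (coeff_A2 f * (c \<epsilon>)^2 * (LINT x|M. D \<epsilon> x * D \<epsilon> x * inverse (Q \<epsilon> x) * p x) + \<epsilon> * Y \<epsilon>))"
proof -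
  have iQ: "esslim M (\<lambda>\<epsilon> x. inverse (Q \<epsilon> x)) (\<lambda>_. inverse 1)"
    by (rule esslim_compose[OF Q]) (auto intro!: continuous_intros)
  define S where "S \<epsilon> x = \<epsilon> * c \<epsilon> * (D \<epsilon> x * inverse (Q \<epsilon> x))" for \<epsilon> x
  have "esslim M (\<lambda>\<epsilon> x. \<epsilon> * c \<epsilon> * (D \<epsilon> x * inverse (Q \<epsilon> x))) (\<lambda>x. 0 * c0 * (\<Delta> x * inverse 1))"
    by (intro esslim_mult D iQ esslim_scalar tendsto_intros c)
  then have S: "esslim M S (\<lambda>_. 0)"
    by (simp add: S_def[abs_def])
  have T: "esslim M (\<lambda>\<epsilon> x. taylor_quot (S \<epsilon> x)) (\<lambda>_. taylor_quot 0)"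
    by (rule esslim_compose[OF S taylor_quot_measurable isCont_taylor_quot])
  \<comment> \<open>What the cubic Taylor term leaves once \<open>\<epsilon>^3\<close> and
    \<open>p\<close> are split off; one of its three factors \<open>inverse (Q \<epsilon> x)\<close>
    cancels against the outer \<open>q\<close>.\<close>
  define W where "W \<epsilon> x = (c \<epsilon>)^3 * (D \<epsilon> x * D \<epsilon> x * D \<epsilon> x * (inverse (Q \<epsilon> x) * inverse (Q \<epsilon> x)) *
      taylor_quot (S \<epsilon> x))" for \<epsilon> x
  have "esslim M W (\<lambda>x. c0^3 * (\<Delta> x * \<Delta> x * \<Delta> x * (inverse 1 * inverse 1) * taylor_quot 0))"
    unfolding W_def[abs_def]
    by (intro esslim_mult D iQ T esslim_scalar tendsto_intros c)
  moreover have "c0^3 * (\<Delta> x * \<Delta> x * \<Delta> x * (inverse 1 * inverse 1) * taylor_quot 0)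
      = coeff_A3 f * c0^3 * \<Delta> x^3" for x
    by (simp add: taylor_quot_def power3_eq_cube)
  ultimately have W: "esslim M W (\<lambda>x. coeff_A3 f * c0^3 * \<Delta> x^3)" by (simp only:)
  define V where "V \<epsilon> x = D \<epsilon> x * D \<epsilon> x * inverse (Q \<epsilon> x)" for \<epsilon> x
  have V: "esslim M V (\<lambda>x. \<Delta> x * \<Delta> x * inverse 1)"
    unfolding V_def[abs_def] by (intro esslim_mult D iQ)
  define Y where "Y \<epsilon> = (LINT x|M. W \<epsilon> x * p x)" for \<epsilon>
  have "(Y \<longlongrightarrow> (LINT x|M. coeff_A3 f * c0^3 * \<Delta> x^3 * p x)) (at 0)"
    unfolding Y_def by (rule esslim_integral[OF W p_integrable]) (simp add: p_pos less_imp_le)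
  moreover have "(LINT x|M. coeff_A3 f * c0^3 * \<Delta> x^3 * p x) = coeff_A3 f * c0^3 * (LINT x|M. \<Delta> x^3 * p x)"
    by (subst integral_mult_right_zero[symmetric]) (simp add: mult.assoc)
  moreover from qr esslimD(3)[OF Q] esslimD(3)[OF D] esslim_integrable[OF W p_integrable]
    esslim_integrable[OF V p_integrable] esslimD(4)[OF Q, of "1 / 2", simplified]
  have "\<forall>\<^sub>F \<epsilon> in at 0. fdiv M f (r \<epsilon>) (q \<epsilon>) =
       \<epsilon>^2 * (coeff_A2 f * (c \<epsilon>)^2 * (LINT x|M. V \<epsilon> x * p x) + \<epsilon> * Y \<epsilon>)"
  proof eventually_elim
    case (elim \<epsilon>)
    note [measurable] = elim(2,3)
    \<comment> \<open>Passing to \<open>fpos\<close> makes the integrand measurable, which the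
      almost everywhere comparison below requires.\<close>
    have "fdiv M f (r \<epsilon>) (q \<epsilon>) =
        (LINT x|M. Q \<epsilon> x * p x * fpos ((Q \<epsilon> x + \<epsilon> * c \<epsilon> * D \<epsilon> x) * p x / (Q \<epsilon> x * p x)))"
      unfolding fdiv_def
    proof (rule Bochner_Integration.integral_cong)
      fix x assume "x \<in> space M"
      with elim(1) show "q \<epsilon> x * f (r \<epsilon> x / q \<epsilon> x) =
          Q \<epsilon> x * p x * fpos ((Q \<epsilon> x + \<epsilon> * c \<epsilon> * D \<epsilon> x) * p x / (Q \<epsilon> x * p x))"
        by (metis divide_nonneg_nonneg fpos_eq)
    qed simp
    also have "\<dots> = (LINT x|M. \<epsilon>^2 * coeff_A2 f * (c \<epsilon>)^2 * (V \<epsilon> x * p x) + \<epsilon>^3 * (W \<epsilon> x * p x))"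
    proof (rule integral_cong_AE)
      show "AE x in M. Q \<epsilon> x * p x * fpos ((Q \<epsilon> x + \<epsilon> * c \<epsilon> * D \<epsilon> x) * p x / (Q \<epsilon> x * p x))
          = \<epsilon>^2 * coeff_A2 f * (c \<epsilon>)^2 * (V \<epsilon> x * p x) + \<epsilon>^3 * (W \<epsilon> x * p x)"
        using elim(6) AE_space
      proof eventually_elim
        case (elim x)
        have Q0: "Q \<epsilon> x \<noteq> 0" using elim(1) by auto
        have *: "(Q \<epsilon> x + \<epsilon> * c \<epsilon> * D \<epsilon> x) * p x / (Q \<epsilon> x * p x) = 1 + S \<epsilon> x"
          using p_pos[OF elim(2)] Q0 by (simp add: S_def field_simps)
        have "Q \<epsilon> x * inverse (Q \<epsilon> x) = 1" using Q0 by simp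
        then show ?case
          unfolding * fpos_taylor V_def W_def S_def by algebra
      qed
    qed (auto simp: V_def W_def S_def)
    also have "\<dots> = \<epsilon>^2 * (coeff_A2 f * (c \<epsilon>)^2 * (LINT x|M. V \<epsilon> x * p x) + \<epsilon> * Y \<epsilon>)"
      using elim(4,5) by (simp add: Y_def power2_eq_square power3_eq_cube algebra_simps)
    finally show ?case .
  qed
  ultimately show ?thesis unfolding V_def by auto
qed

text \<open>Relative to the mixture the inputs are displaced by \<open>- s\<close> and
  \<open>1 - s\<close> times the same \<open>\<epsilon> D p\<close>, so one quadratic factor
  \<open>X\<close> serves both. The minus sign in the limit of \<open>YA\<close> is the cube of the
  negative displacement.\<close>

lemma fdiv_pair_expansion:
  assumes A: "first_order qA u" and B: "first_order qB v"
    and s: "(s \<longlongrightarrow> s0) (at 0)" "\<forall>\<^sub>F \<epsilon> in at 0. s \<epsilon> \<in> {0..1}"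
  obtains X YA YB where
    "(X \<longlongrightarrow> (LINT x|M. (v x - u x)^2 * p x)) (at 0)"
    "(YA \<longlongrightarrow> - (coeff_A3 f * s0^3 * (LINT x|M. (v x - u x)^3 * p x))) (at 0)"
    "(YB \<longlongrightarrow> coeff_A3 f * (1 - s0)^3 * (LINT x|M. (v x - u x)^3 * p x)) (at 0)"
    "\<forall>\<^sub>F \<epsilon> in at 0.
       fdiv M f (qA \<epsilon>) (mix (s \<epsilon>) (qA \<epsilon>) (qB \<epsilon>)) = \<epsilon>^2 * (coeff_A2 f * (s \<epsilon>)^2 * X \<epsilon> + \<epsilon> * YA \<epsilon>) \<and>
       fdiv M f (qB \<epsilon>) (mix (s \<epsilon>) (qA \<epsilon>) (qB \<epsilon>)) = \<epsilon>^2 * (coeff_A2 f * (1 - s \<epsilon>)^2 * X \<epsilon> + \<epsilon> * YB \<epsilon>)"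
proof -
  let ?q = "\<lambda>\<epsilon>. mix (s \<epsilon>) (qA \<epsilon>) (qB \<epsilon>)"
  \<comment> \<open>The constants \<open>1\<close> cancel, so \<open>D\<close> is
    \<open>(qB - qA) / (\<epsilon> p)\<close>.\<close>
  define D where "D \<epsilon> x = (qB \<epsilon> x / p x - 1) / \<epsilon> - (qA \<epsilon> x / p x - 1) / \<epsilon>" for \<epsilon> x
  define Q where "Q \<epsilon> x = ?q \<epsilon> x / p x" for \<epsilon> x
  have D: "esslim M D (\<lambda>x. v x - u x)"
    unfolding D_def[abs_def] using A B by (intro esslim_diff) (auto simp: first_order_def)
  note mix = first_order_mix[OF A B s]
  have Q: "esslim M Q (\<lambda>_. 1)"
    unfolding Q_def[abs_def] by (rule first_order_ratio[OF mix])
  have pos: "\<forall>\<^sub>F \<epsilon> in at 0. \<forall>x\<in>space M. 0 \<le> qA \<epsilon> x" "\<forall>\<^sub>F \<epsilon> in at 0. \<forall>x\<in>space M. 0 \<le> qB \<epsilon> x"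
    "\<forall>\<^sub>F \<epsilon> in at 0. \<forall>x\<in>space M. 0 \<le> ?q \<epsilon> x"
    using A B mix by (auto simp: first_order_def)
  have ne: "\<forall>\<^sub>F \<epsilon> in at (0::real). \<epsilon> \<noteq> 0" by (simp add: eventually_at_filter)
  define X where "X \<epsilon> = (LINT x|M. D \<epsilon> x * D \<epsilon> x * inverse (Q \<epsilon> x) * p x)" for \<epsilon>
  have "esslim M (\<lambda>\<epsilon> x. D \<epsilon> x * D \<epsilon> x * inverse (Q \<epsilon> x)) (\<lambda>x. (v x - u x) * (v x - u x) * inverse 1)"
    by (intro esslim_mult D esslim_compose[OF Q]) (auto intro!: continuous_intros)
  then have "(X \<longlongrightarrow> (LINT x|M. (v x - u x) * (v x - u x) * inverse 1 * p x)) (at 0)"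
    unfolding X_def by (rule esslim_integral[OF _ p_integrable]) (simp add: p_pos less_imp_le)
  then have X: "(X \<longlongrightarrow> (LINT x|M. (v x - u x)^2 * p x)) (at 0)"
    by (simp add: power2_eq_square)
  have "\<forall>\<^sub>F \<epsilon> in at 0. \<forall>x\<in>space M. 0 \<le> ?q \<epsilon> x \<and> 0 \<le> qA \<epsilon> x \<and>
      ?q \<epsilon> x = Q \<epsilon> x * p x \<and> qA \<epsilon> x = (Q \<epsilon> x + \<epsilon> * (- s \<epsilon>) * D \<epsilon> x) * p x"
    using pos ne
  proof eventually_elim
    case (elim \<epsilon>)
    show ?case
    proof
      fix x assume x: "x \<in> space M"
      show "0 \<le> ?q \<epsilon> x \<and> 0 \<le> qA \<epsilon> x \<and> ?q \<epsilon> x = Q \<epsilon> x * p x \<and> qA \<epsilon> x = (Q \<epsilon> x + \<epsilon> * (- s \<epsilon>) * D \<epsilon> x) * p x"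
        using elim x p_pos[OF x] by (simp add: Q_def D_def mix_def field_simps)
    qed
  qed
  from fdiv_expansion[OF D Q tendsto_minus[OF s(1)] this]
  obtain YA where YA: "(YA \<longlongrightarrow> - (coeff_A3 f * s0^3 * (LINT x|M. (v x - u x)^3 * p x))) (at 0)"
    "\<forall>\<^sub>F \<epsilon> in at 0. fdiv M f (qA \<epsilon>) (?q \<epsilon>) = \<epsilon>^2 * (coeff_A2 f * (s \<epsilon>)^2 * X \<epsilon> + \<epsilon> * YA \<epsilon>)"
    by (auto simp: X_def)
  have "\<forall>\<^sub>F \<epsilon> in at 0. \<forall>x\<in>space M. 0 \<le> ?q \<epsilon> x \<and> 0 \<le> qB \<epsilon> x \<and>
      ?q \<epsilon> x = Q \<epsilon> x * p x \<and> qB \<epsilon> x = (Q \<epsilon> x + \<epsilon> * (1 - s \<epsilon>) * D \<epsilon> x) * p x"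
    using pos ne
  proof eventually_elim
    case (elim \<epsilon>)
    show ?case
    proof
      fix x assume x: "x \<in> space M"
      show "0 \<le> ?q \<epsilon> x \<and> 0 \<le> qB \<epsilon> x \<and> ?q \<epsilon> x = Q \<epsilon> x * p x \<and> qB \<epsilon> x = (Q \<epsilon> x + \<epsilon> * (1 - s \<epsilon>) * D \<epsilon> x) * p x"
        using elim x p_pos[OF x] by (simp add: Q_def D_def mix_def field_simps)
    qed
  qed
  from fdiv_expansion[OF D Q tendsto_diff[OF tendsto_const s(1)] this]
  obtain YB where YB: "(YB \<longlongrightarrow> coeff_A3 f * (1 - s0)^3 * (LINT x|M. (v x - u x)^3 * p x)) (at 0)"
    "\<forall>\<^sub>F \<epsilon> in at 0. fdiv M f (qB \<epsilon>) (?q \<epsilon>) = \<epsilon>^2 * (coeff_A2 f * (1 - s \<epsilon>)^2 * X \<epsilon> + \<epsilon> * YB \<epsilon>)"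
    by (auto simp: X_def)
  show thesis
    by (rule that[OF X YA(1) YB(1) eventually_conj[OF YA(2) YB(2)]])
qed

section \<open>The balance equation\<close>

text \<open>At a fixed weight the terms of order \<open>\<epsilon>^2\<close> decide each comparison,
  and the difference of their coefficients has the sign of \<open>s - \<theta>\<close>.\<close>

lemma divergence_sign:
  assumes "first_order qA u" "first_order qB v" "gA > 0" "gB > 0"
    and J: "(LINT x|M. (v x - u x)^2 * p x) > 0" and s: "0 < s" "s < 1"
  defines "\<theta> \<equiv> gB / (gA + gB)"
  shows "\<forall>\<^sub>F \<epsilon> in at 0. fdiv M f (qA \<epsilon>) (mix s (qA \<epsilon>) (qB \<epsilon>)) > 0"
    and "s < \<theta> \<Longrightarrow> \<forall>\<^sub>F \<epsilon> in at 0. gA^2 * fdiv M f (qA \<epsilon>) (mix s (qA \<epsilon>) (qB \<epsilon>))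
      < gB^2 * fdiv M f (qB \<epsilon>) (mix s (qA \<epsilon>) (qB \<epsilon>))"
    and "s > \<theta> \<Longrightarrow> \<forall>\<^sub>F \<epsilon> in at 0. gA^2 * fdiv M f (qA \<epsilon>) (mix s (qA \<epsilon>) (qB \<epsilon>))
      > gB^2 * fdiv M f (qB \<epsilon>) (mix s (qA \<epsilon>) (qB \<epsilon>))"
proof -
  define J where "J = (LINT x|M. (v x - u x)^2 * p x)"
  have J0: "J > 0" using J by (simp add: J_def)
  define FA FB where "FA \<epsilon> = fdiv M f (qA \<epsilon>) (mix s (qA \<epsilon>) (qB \<epsilon>))"
    and "FB \<epsilon> = fdiv M f (qB \<epsilon>) (mix s (qA \<epsilon>) (qB \<epsilon>))" for \<epsilon>
  define yA where "yA = - (coeff_A3 f * s^3 * (LINT x|M. (v x - u x)^3 * p x))"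
  define yB where "yB = coeff_A3 f * (1 - s)^3 * (LINT x|M. (v x - u x)^3 * p x)"
  have "\<forall>\<^sub>F \<epsilon> in at (0::real). s \<in> {0..1}" using s by simp
  from fdiv_pair_expansion[OF assms(1,2) tendsto_const this, folded FA_def FB_def J_def yA_def yB_def]
  obtain X YA YB where X: "(X \<longlongrightarrow> J) (at 0)" and Y: "(YA \<longlongrightarrow> yA) (at 0)" "(YB \<longlongrightarrow> yB) (at 0)"
    and F: "\<forall>\<^sub>F \<epsilon> in at 0. FA \<epsilon> = \<epsilon>^2 * (coeff_A2 f * s^2 * X \<epsilon> + \<epsilon> * YA \<epsilon>) \<and>
      FB \<epsilon> = \<epsilon>^2 * (coeff_A2 f * (1 - s)^2 * X \<epsilon> + \<epsilon> * YB \<epsilon>)" .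
  define a where "a \<epsilon> = coeff_A2 f * s^2 * X \<epsilon> + \<epsilon> * YA \<epsilon>" for \<epsilon>
  define b where "b \<epsilon> = coeff_A2 f * (1 - s)^2 * X \<epsilon> + \<epsilon> * YB \<epsilon>" for \<epsilon>
  define a0 where "a0 = coeff_A2 f * s^2 * J"
  define b0 where "b0 = coeff_A2 f * (1 - s)^2 * J"
  have "(a \<longlongrightarrow> a0 + 0 * yA) (at 0)" unfolding a_def a0_def by (intro tendsto_intros X Y)
  then have a: "(a \<longlongrightarrow> a0) (at 0)" by simp
  have "(b \<longlongrightarrow> b0 + 0 * yB) (at 0)" unfolding b_def b0_def by (intro tendsto_intros X Y)
  then have b: "(b \<longlongrightarrow> b0) (at 0)" by simp
  have F': "\<forall>\<^sub>F \<epsilon> in at 0. FA \<epsilon> = \<epsilon>^2 * a \<epsilon> \<and> FB \<epsilon> = \<epsilon>^2 * b \<epsilon> \<and> \<epsilon>^2 > 0"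
    using F eventually_neq_at_within[of 0 0 UNIV] by eventually_elim (simp add: a_def b_def)
  have "a0 > 0" using A2_pos J0 s by (simp add: a0_def)
  from order_tendstoD(1)[OF a this] F'
  have "\<forall>\<^sub>F \<epsilon> in at 0. FA \<epsilon> > 0" by eventually_elim simp
  then show "\<forall>\<^sub>F \<epsilon> in at 0. fdiv M f (qA \<epsilon>) (mix s (qA \<epsilon>) (qB \<epsilon>)) > 0" by (simp add: FA_def)
  have lim: "((\<lambda>\<epsilon>. gA^2 * a \<epsilon> - gB^2 * b \<epsilon>) \<longlongrightarrow> gA^2 * a0 - gB^2 * b0) (at 0)"
    by (intro tendsto_intros a b)
  \<comment> \<open>A difference of the squares of \<open>gA * s\<close> and
    \<open>gB * (1 - s)\<close>; only the last factor can change sign, and it vanishes at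
    \<open>\<theta>\<close>.\<close>
  have factored: "gA^2 * a0 - gB^2 * b0 = coeff_A2 f * J * (gA * s + gB * (1 - s)) * ((gA + gB) * s - gB)"
    unfolding a0_def b0_def by algebra
  have pos: "coeff_A2 f * J * (gA * s + gB * (1 - s)) > 0"
    using A2_pos J0 s assms(3,4) by (intro mult_pos_pos add_pos_pos) auto
  show "\<forall>\<^sub>F \<epsilon> in at 0. gA^2 * fdiv M f (qA \<epsilon>) (mix s (qA \<epsilon>) (qB \<epsilon>))
      < gB^2 * fdiv M f (qB \<epsilon>) (mix s (qA \<epsilon>) (qB \<epsilon>))" if "s < \<theta>"
  proof -
    have "(gA + gB) * s - gB < 0" using that assms(3,4) by (simp add: \<theta>_def field_simps)
    then have "gA^2 * a0 - gB^2 * b0 < 0" unfolding factored using pos by (simp add: mult_pos_neg)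
    from order_tendstoD(2)[OF lim this] F' have "\<forall>\<^sub>F \<epsilon> in at 0. gA^2 * FA \<epsilon> < gB^2 * FB \<epsilon>"
    proof eventually_elim
      case (elim \<epsilon>)
      then have "\<epsilon>^2 * (gA^2 * a \<epsilon> - gB^2 * b \<epsilon>) < 0" by (simp add: mult_pos_neg)
      then show ?case using elim(2) by (simp add: algebra_simps)
    qed
    then show ?thesis by (simp add: FA_def FB_def)
  qed
  show "\<forall>\<^sub>F \<epsilon> in at 0. gA^2 * fdiv M f (qA \<epsilon>) (mix s (qA \<epsilon>) (qB \<epsilon>))
      > gB^2 * fdiv M f (qB \<epsilon>) (mix s (qA \<epsilon>) (qB \<epsilon>))" if "s > \<theta>"
  proof -
    have "(gA + gB) * s - gB > 0" using that assms(3,4) by (simp add: \<theta>_def field_simps)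
    then have "gA^2 * a0 - gB^2 * b0 > 0" unfolding factored using pos by simp
    from order_tendstoD(1)[OF lim this] F' have "\<forall>\<^sub>F \<epsilon> in at 0. gA^2 * FA \<epsilon> > gB^2 * FB \<epsilon>"
    proof eventually_elim
      case (elim \<epsilon>)
      then have "\<epsilon>^2 * (gA^2 * a \<epsilon> - gB^2 * b \<epsilon>) > 0" by simp
      then show ?case using elim(2) by (simp add: algebra_simps)
    qed
    then show ?thesis by (simp add: FA_def FB_def)
  qed
qed

section \<open>Existence and rate of the local solution\<close>

lemma balanced_root:
  assumes "near qA" "near qB" "0 < c" "c < d" "d < 1"
    and "gA^2 * fdiv M f qA (mix c qA qB) < gB^2 * fdiv M f qB (mix c qA qB)"
    and "gA^2 * fdiv M f qA (mix d qA qB) > gB^2 * fdiv M f qB (mix d qA qB)"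
  shows "\<exists>s. c < s \<and> s < d \<and> balanced M f gA gB qA qB s"
proof -
  let ?\<Phi> = "\<lambda>s. gA^2 * fdiv M f qA (mix s qA qB) - gB^2 * fdiv M f qB (mix s qA qB)"
  \<comment> \<open>Convexity gives continuity in the interior, hence the open interval, which
    contains \<open>{c..d}\<close>.\<close>
  have "continuous_on {0<..<1} (\<lambda>s. fdiv M f r (mix s qA qB))" if "near r" for r
    by (rule convex_on_continuous)
      (auto intro!: convex_on_subset[OF fdiv_mix_convex[OF that assms(1,2)]])
  then have "continuous_on {0<..<1} ?\<Phi>"
    using assms(1,2) by (intro continuous_intros) auto
  then have cont: "continuous_on {c..d} ?\<Phi>"
    by (rule continuous_on_subset) (use assms in auto)
  obtain s where s: "c \<le> s" "s \<le> d" "?\<Phi> s = 0"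
    using IVT'[of ?\<Phi> c 0 d] cont assms by auto
  moreover have "s \<noteq> c" "s \<noteq> d" using s assms by auto
  ultimately show ?thesis by (intro exI[of _ s]) (auto simp: balanced_def)
qed

text \<open>The sign change between \<open>\<theta> - e\<close> and \<open>\<theta> + e\<close>
  yields a balanced weight within every small radius. Uniqueness in one fixed ball identifies all of
  them, so they converge to \<open>\<theta>\<close>.\<close>

lemma local_solution_exists:
  assumes A: "first_order qA u" and B: "first_order qB v" and g: "gA > 0" "gB > 0"
    and J: "(LINT x|M. (v x - u x)^2 * p x) > 0"
  shows "\<exists>t. local_solution M f gA gB qA qB t"
proof -
  define \<theta> where "\<theta> = gB / (gA + gB)"
  have \<theta>: "0 < \<theta>" "\<theta> < 1" using g by (auto simp: \<theta>_def)
  \<comment> \<open>Half the distance to the nearer endpoint keeps \<open>\<theta> - \<eta>\<close>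
    and \<open>\<theta> + \<eta>\<close> strictly between \<open>0\<close> and
    \<open>1\<close>.\<close>
  define \<eta> where "\<eta> = min \<theta> (1 - \<theta>) / 2"
  have \<eta>: "\<eta> > 0" "0 < \<theta> - \<eta>" "\<theta> + \<eta> < 1" using \<theta> by (auto simp: \<eta>_def min_def field_simps)
  let ?bal = "\<lambda>\<epsilon>. balanced M f gA gB (qA \<epsilon>) (qB \<epsilon>)"
  note sign = divergence_sign[OF A B g J, folded \<theta>_def]
  \<comment> \<open>The radius stays free: \<open>\<eta>\<close> itself gives existence, smaller
    radii give the convergence.\<close>
  have root: "\<forall>\<^sub>F \<epsilon> in at 0. \<exists>s\<in>ball \<theta> e. ?bal \<epsilon> s" if e: "0 < e" "e \<le> \<eta>" for e
  proof -
    have "\<theta> - e > 0" "\<theta> - e < 1" "\<theta> - e < \<theta>" "\<theta> + e > 0" "\<theta> + e < 1" "\<theta> + e > \<theta>"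
      using e \<eta> \<theta> by auto
    note sign(2)[OF this(1-3)] sign(3)[OF this(4-6)]
    with first_order_near[OF A] first_order_near[OF B] show ?thesis
    proof eventually_elim
      case (elim \<epsilon>)
      then have "\<exists>s. \<theta> - e < s \<and> s < \<theta> + e \<and> ?bal \<epsilon> s"
        using e \<eta> by (intro balanced_root) auto
      then show ?case by (auto simp: dist_real_def abs_less_iff)
    qed
  qed
  have unique: "\<forall>\<^sub>F \<epsilon> in at 0. \<forall>s\<in>ball \<theta> \<eta>. \<forall>t\<in>ball \<theta> \<eta>. ?bal \<epsilon> s \<longrightarrow> ?bal \<epsilon> t \<longrightarrow> s = t"
  proof -
    have "\<theta> - \<eta> < 1" using \<eta> \<theta> by auto
    note sign(1)[OF \<eta>(2) this]
    with first_order_near[OF A] first_order_near[OF B] show ?thesis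
    proof eventually_elim
      case (elim \<epsilon>)
      \<comment> \<open>The left end \<open>\<theta> - \<eta>\<close> of the ball serves as the
        anchor where the divergence of \<open>qA\<close> is positive.\<close>
      have *: "s = t" if "s \<in> ball \<theta> \<eta>" "t \<in> ball \<theta> \<eta>" "?bal \<epsilon> s" "?bal \<epsilon> t" "s \<le> t" for s t
        using that \<eta> elim g
        by (intro balanced_unique[of "qA \<epsilon>" "qB \<epsilon>" gA "\<theta> - \<eta>" t s gB]) (auto simp: dist_real_def)
      show ?case by (metis * linear)
    qed
  qed
  define t where "t \<epsilon> = (SOME s. s \<in> ball \<theta> \<eta> \<and> ?bal \<epsilon> s)" for \<epsilon>
  have t: "\<forall>\<^sub>F \<epsilon> in at 0. t \<epsilon> \<in> ball \<theta> \<eta> \<and> ?bal \<epsilon> (t \<epsilon>)"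
    using root[OF \<eta>(1) order_refl]
  proof eventually_elim
    case (elim \<epsilon>)
    then have "\<exists>s. s \<in> ball \<theta> \<eta> \<and> ?bal \<epsilon> s" by blast
    then show ?case unfolding t_def by (rule someI_ex)
  qed
  have "(t \<longlongrightarrow> \<theta>) (at 0)"
  proof (rule tendstoI)
    fix e :: real assume "e > 0"
    then have e: "0 < min e \<eta>" "min e \<eta> \<le> \<eta>" using \<eta> by auto
    \<comment> \<open>The balanced weight found in the smaller ball must be
      \<open>t \<epsilon>\<close> by uniqueness.\<close>
    from root[OF e] t unique show "\<forall>\<^sub>F \<epsilon> in at 0. dist (t \<epsilon>) \<theta> < e"
    proof eventually_elim
      case (elim \<epsilon>)
      then obtain s where s: "s \<in> ball \<theta> (min e \<eta>)" "?bal \<epsilon> s" by blast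
      then have "s \<in> ball \<theta> \<eta>" by simp
      with elim s have "t \<epsilon> = s" by blast
      with s show ?case by (simp add: dist_commute)
    qed
  qed
  moreover have "\<forall>\<^sub>F \<epsilon> in at 0. t \<epsilon> \<in> {0..1} \<and> t \<epsilon> \<in> ball \<theta> \<eta> \<and>
      (\<forall>s\<in>ball \<theta> \<eta>. ?bal \<epsilon> s \<longleftrightarrow> s = t \<epsilon>)"
    using t unique
  proof eventually_elim
    case (elim \<epsilon>)
    then have "t \<epsilon> \<in> {0..1}" using \<eta> by (auto simp: dist_real_def)
    with elim show ?case by blast
  qed
  ultimately have "local_solution M f gA gB qA qB t"
    unfolding local_solution_def Let_def \<theta>_def[symmetric] using \<eta>(1) by blast
  then show ?thesis by blast
qed

text \<open>Divided by \<open>\<epsilon>^2\<close>, the balance equation equates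
  \<open>t - \<theta>\<close> times a factor with positive limit to \<open>\<epsilon>\<close> times
  a convergent quantity.\<close>

lemma local_solution_rate:
  assumes A: "first_order qA u" and B: "first_order qB v" and g: "gA > 0" "gB > 0"
    and J: "(LINT x|M. (v x - u x)^2 * p x) > 0"
    and t: "local_solution M f gA gB qA qB t"
  shows "((\<lambda>\<epsilon>. (t \<epsilon> - gB / (gA + gB)) / \<epsilon>) \<longlongrightarrow> tau M p f (gA^2) (gB^2) u v) (at 0)"
proof -
  define \<theta> where "\<theta> = gB / (gA + gB)"
  define J L3 where "J = (LINT x|M. (v x - u x)^2 * p x)" and "L3 = (LINT x|M. (v x - u x)^3 * p x)"
  have J0: "J > 0" using J by (simp add: J_def)
  have t0: "(t \<longlongrightarrow> \<theta>) (at 0)" using t by (simp add: local_solution_def \<theta>_def Let_def)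
  have ev: "\<forall>\<^sub>F \<epsilon> in at 0. t \<epsilon> \<in> {0..1} \<and> balanced M f gA gB (qA \<epsilon>) (qB \<epsilon>) (t \<epsilon>)"
    using t unfolding local_solution_def Let_def by (auto elim!: eventually_mono)
  then have "\<forall>\<^sub>F \<epsilon> in at 0. t \<epsilon> \<in> {0..1}" by (rule eventually_mono) simp
  from fdiv_pair_expansion[OF A B t0 this, folded J_def L3_def]
  obtain X YA YB where X: "(X \<longlongrightarrow> J) (at 0)"
    and Y: "(YA \<longlongrightarrow> - (coeff_A3 f * \<theta>^3 * L3)) (at 0)" "(YB \<longlongrightarrow> coeff_A3 f * (1 - \<theta>)^3 * L3) (at 0)"
    and F: "\<forall>\<^sub>F \<epsilon> in at 0.
       fdiv M f (qA \<epsilon>) (mix (t \<epsilon>) (qA \<epsilon>) (qB \<epsilon>)) = \<epsilon>^2 * (coeff_A2 f * (t \<epsilon>)^2 * X \<epsilon> + \<epsilon> * YA \<epsilon>) \<and>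
       fdiv M f (qB \<epsilon>) (mix (t \<epsilon>) (qA \<epsilon>) (qB \<epsilon>)) = \<epsilon>^2 * (coeff_A2 f * (1 - t \<epsilon>)^2 * X \<epsilon> + \<epsilon> * YB \<epsilon>)" .
  \<comment> \<open>The factor of \<open>t \<epsilon> - \<theta>\<close> in the divided balance
    equation; its positive limit \<open>d0\<close> permits dividing by it.\<close>
  define d where "d \<epsilon> = coeff_A2 f * X \<epsilon> * ((gA + gB) * (gA * t \<epsilon> + gB * (1 - t \<epsilon>)))" for \<epsilon>
  define d0 where "d0 = coeff_A2 f * J * ((gA + gB) * (gA * \<theta> + gB * (1 - \<theta>)))"
  have d: "(d \<longlongrightarrow> d0) (at 0)" unfolding d_def d0_def by (intro tendsto_intros X t0)
  have \<theta>: "0 < \<theta>" "\<theta> < 1" using g by (auto simp: \<theta>_def)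
  then have d0: "d0 > 0"
    unfolding d0_def using A2_pos J0 g by (intro mult_pos_pos add_pos_pos) auto
  have lim: "((\<lambda>\<epsilon>. (gB^2 * YB \<epsilon> - gA^2 * YA \<epsilon>) / d \<epsilon>) \<longlongrightarrow>
      (gB^2 * (coeff_A3 f * (1 - \<theta>)^3 * L3) - gA^2 * (- (coeff_A3 f * \<theta>^3 * L3))) / d0) (at 0)"
    using d0 by (intro tendsto_intros Y d) auto
  have val: "(gB^2 * (coeff_A3 f * (1 - \<theta>)^3 * L3) - gA^2 * (- (coeff_A3 f * \<theta>^3 * L3))) / d0
      = tau M p f (gA^2) (gB^2) u v"
  proof -
    \<comment> \<open>Both sides are \<open>2 * gA * gB\<close>, by the value of
      \<open>\<theta>\<close>; this is the origin of the \<open>2\<close> in the denominator of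
      \<open>tau\<close>.\<close>
    have "(gA + gB) * (gA * \<theta> + gB * (1 - \<theta>)) = 2 * (gA^2 * \<theta> + gB^2 * (1 - \<theta>))"
      using g by (simp add: \<theta>_def field_simps power2_eq_square)
    then have "d0 = 2 * coeff_A2 f * J * (gA^2 * \<theta> + gB^2 * (1 - \<theta>))" by (simp add: d0_def)
    moreover have "sqrt (gB^2) / (sqrt (gA^2) + sqrt (gB^2)) = \<theta>" using g by (simp add: \<theta>_def)
    ultimately show ?thesis
      unfolding tau_def Let_def J_def[symmetric] L3_def[symmetric] by (simp add: algebra_simps)
  qed
  have eq: "\<forall>\<^sub>F \<epsilon> in at 0. (gB^2 * YB \<epsilon> - gA^2 * YA \<epsilon>) / d \<epsilon> = (t \<epsilon> - \<theta>) / \<epsilon>"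
    using ev F order_tendstoD(1)[OF d d0] eventually_neq_at_within[of 0 0 UNIV]
  proof eventually_elim
    case (elim \<epsilon>)
    have "gA^2 * (\<epsilon>^2 * (coeff_A2 f * (t \<epsilon>)^2 * X \<epsilon> + \<epsilon> * YA \<epsilon>)) =
        gB^2 * (\<epsilon>^2 * (coeff_A2 f * (1 - t \<epsilon>)^2 * X \<epsilon> + \<epsilon> * YB \<epsilon>))"
      using elim(1,2) by (simp add: balanced_def)
    then have "\<epsilon>^2 * (gA^2 * (coeff_A2 f * (t \<epsilon>)^2 * X \<epsilon> + \<epsilon> * YA \<epsilon>)) =
        \<epsilon>^2 * (gB^2 * (coeff_A2 f * (1 - t \<epsilon>)^2 * X \<epsilon> + \<epsilon> * YB \<epsilon>))"
      by (simp add: ac_simps)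
    then have "gA^2 * (coeff_A2 f * (t \<epsilon>)^2 * X \<epsilon> + \<epsilon> * YA \<epsilon>) =
        gB^2 * (coeff_A2 f * (1 - t \<epsilon>)^2 * X \<epsilon> + \<epsilon> * YB \<epsilon>)"
      using elim(4) by simp
    \<comment> \<open>The same difference of squares as in \<open>divergence_sign\<close>, with the
      terms carrying \<open>\<epsilon>\<close> moved to the right.\<close>
    then have "coeff_A2 f * X \<epsilon> * (gA * t \<epsilon> + gB * (1 - t \<epsilon>)) * ((gA + gB) * t \<epsilon> - gB)
        = \<epsilon> * (gB^2 * YB \<epsilon> - gA^2 * YA \<epsilon>)"
      by algebra
    moreover have "(gA + gB) * t \<epsilon> - gB = (gA + gB) * (t \<epsilon> - \<theta>)"
      using g by (simp add: \<theta>_def field_simps)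
    ultimately have "d \<epsilon> * (t \<epsilon> - \<theta>) = \<epsilon> * (gB^2 * YB \<epsilon> - gA^2 * YA \<epsilon>)"
      by (simp add: d_def ac_simps)
    then show ?case using elim(3,4) by (simp add: frac_eq_eq ac_simps)
  qed
  show ?thesis
    unfolding \<theta>_def[symmetric] by (rule Lim_transform_eventually[OF lim[unfolded val] eq])
qed

section \<open>Second-order expansions through a single merge\<close>

text \<open>The constant family only says that \<open>h / p\<close> is measurable and essentially bounded.\<close>

definition second_order :: "(real \<Rightarrow> 'a \<Rightarrow> real) \<Rightarrow> ('a \<Rightarrow> real) \<Rightarrow> ('a \<Rightarrow> real) \<Rightarrow> bool" where
  "second_order q h b \<longleftrightarrow> (\<forall>\<^sub>F \<epsilon> in at 0. \<forall>x\<in>space M. 0 \<le> q \<epsilon> x) \<and>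
     esslim M (\<lambda>_ x. h x / p x) (\<lambda>x. h x / p x) \<and>
     esslim M (\<lambda>\<epsilon> x. (q \<epsilon> x / p x - 1 - \<epsilon> * (h x / p x)) / \<epsilon>^2) (\<lambda>x. b x / p x)"

lemma second_order_first_order:
  assumes "second_order q h b"
  shows "first_order q (\<lambda>x. h x / p x)"
  unfolding first_order_def
proof
  have "esslim M (\<lambda>\<epsilon> x. h x / p x + \<epsilon> * ((q \<epsilon> x / p x - 1 - \<epsilon> * (h x / p x)) / \<epsilon>^2))
      (\<lambda>x. h x / p x + 0 * (b x / p x))"
    using assms unfolding second_order_def
    by (intro esslim_add esslim_mult esslim_scalar tendsto_intros) auto
  then show "esslim M (\<lambda>\<epsilon> x. (q \<epsilon> x / p x - 1) / \<epsilon>) (\<lambda>x. h x / p x)"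
  proof (rule esslim_cong)
    show "\<forall>\<^sub>F \<epsilon> in at 0. \<forall>x\<in>space M. h x / p x + \<epsilon> * ((q \<epsilon> x / p x - 1 - \<epsilon> * (h x / p x)) / \<epsilon>^2)
        = (q \<epsilon> x / p x - 1) / \<epsilon>"
      using eventually_neq_at_within[of 0 0 UNIV]
    proof eventually_elim
      case (elim \<epsilon>)
      have "a + \<epsilon> * ((c - \<epsilon> * a) / \<epsilon>^2) = c / \<epsilon>" for a c
        using elim by (simp add: field_simps power2_eq_square)
      then show ?case by blast
    qed
  qed simp
qed (use assms in \<open>simp add: second_order_def\<close>)

text \<open>With \<open>t = \<theta> + \<epsilon> \<sigma>\<close>, the first-order terms contribute
  \<open>\<epsilon>^2 \<sigma> (hB - hA)\<close> beyond their \<open>\<theta>\<close>-average. The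
  rate \<open>\<tau>\<close> of the weight thus enters at second order, while the second-order
  inputs see only its limit \<open>\<theta>\<close>.\<close>

lemma second_order_merge:
  assumes A: "second_order qA hA bA" and B: "second_order qB hB bB" and g: "gA > 0" "gB > 0"
    and J: "(LINT x|M. ((hB x - hA x) / p x)^2 * p x) > 0"
  defines "\<theta> \<equiv> gB / (gA + gB)"
    and "\<tau> \<equiv> tau M p f (gA^2) (gB^2) (\<lambda>x. hA x / p x) (\<lambda>x. hB x / p x)"
  shows "second_order (\<lambda>\<epsilon>. mix (merge_weight M f gA gB qA qB \<epsilon>) (qA \<epsilon>) (qB \<epsilon>))
    (\<lambda>x. (gA * hA x + gB * hB x) / (gA + gB))
    (\<lambda>x. (1 - \<theta>) * bA x + \<theta> * bB x + \<tau> * (hB x - hA x))"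
proof -
  define t where "t = merge_weight M f gA gB qA qB"
  note A1 = second_order_first_order[OF A] and B1 = second_order_first_order[OF B]
  have J': "(LINT x|M. (hB x / p x - hA x / p x)^2 * p x) > 0"
    using J by (simp add: diff_divide_distrib)
  \<comment> \<open>Existence makes the weight selected by \<open>merge_weight\<close> a genuine
    local solution.\<close>
  have t: "local_solution M f gA gB qA qB t"
    unfolding t_def merge_weight_def by (rule someI_ex[OF local_solution_exists[OF A1 B1 g J']])
  define \<sigma> where "\<sigma> \<epsilon> = (t \<epsilon> - \<theta>) / \<epsilon>" for \<epsilon>
  have \<sigma>: "(\<sigma> \<longlongrightarrow> \<tau>) (at 0)"
    unfolding \<sigma>_def \<tau>_def \<theta>_def by (rule local_solution_rate[OF A1 B1 g J' t])
  have t0: "(t \<longlongrightarrow> \<theta>) (at 0)" using t by (simp add: local_solution_def \<theta>_def Let_def)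
  have t01: "\<forall>\<^sub>F \<epsilon> in at 0. t \<epsilon> \<in> {0..1}"
    using t unfolding local_solution_def Let_def by (auto elim!: eventually_mono)
  have mean: "(gA * hA x + gB * hB x) / (gA + gB) / p x = (1 - \<theta>) * (hA x / p x) + \<theta> * (hB x / p x)" for x
  proof -
    have "1 - \<theta> = gA / (gA + gB)" using g by (simp add: \<theta>_def field_simps)
    then show ?thesis by (simp add: \<theta>_def add_divide_distrib)
  qed
  show ?thesis
    unfolding second_order_def t_def[symmetric] mean
  proof (intro conjI)
    show "\<forall>\<^sub>F \<epsilon> in at 0. \<forall>x\<in>space M. 0 \<le> mix (t \<epsilon>) (qA \<epsilon>) (qB \<epsilon>) x"
      using first_order_mix[OF A1 B1 t0 t01] by (simp add: first_order_def)
    show "esslim M (\<lambda>_ x. (1 - \<theta>) * (hA x / p x) + \<theta> * (hB x / p x))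
        (\<lambda>x. (1 - \<theta>) * (hA x / p x) + \<theta> * (hB x / p x))"
      using A B unfolding second_order_def
      by (intro esslim_add esslim_mult esslim_scalar tendsto_intros) auto
    have "esslim M (\<lambda>\<epsilon> x. (1 - t \<epsilon>) * ((qA \<epsilon> x / p x - 1 - \<epsilon> * (hA x / p x)) / \<epsilon>^2)
          + t \<epsilon> * ((qB \<epsilon> x / p x - 1 - \<epsilon> * (hB x / p x)) / \<epsilon>^2) + \<sigma> \<epsilon> * (hB x / p x - hA x / p x))
        (\<lambda>x. (1 - \<theta>) * (bA x / p x) + \<theta> * (bB x / p x) + \<tau> * (hB x / p x - hA x / p x))"
      using A B unfolding second_order_def
      by (intro esslim_add esslim_mult esslim_diff esslim_scalar tendsto_intros t0 \<sigma>) auto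
    then show "esslim M (\<lambda>\<epsilon> x. (mix (t \<epsilon>) (qA \<epsilon>) (qB \<epsilon>) x / p x - 1 -
          \<epsilon> * ((1 - \<theta>) * (hA x / p x) + \<theta> * (hB x / p x))) / \<epsilon>^2)
        (\<lambda>x. ((1 - \<theta>) * bA x + \<theta> * bB x + \<tau> * (hB x - hA x)) / p x)"
    proof (rule esslim_cong)
      show "\<forall>\<^sub>F \<epsilon> in at 0. \<forall>x\<in>space M.
          (1 - t \<epsilon>) * ((qA \<epsilon> x / p x - 1 - \<epsilon> * (hA x / p x)) / \<epsilon>^2)
          + t \<epsilon> * ((qB \<epsilon> x / p x - 1 - \<epsilon> * (hB x / p x)) / \<epsilon>^2) + \<sigma> \<epsilon> * (hB x / p x - hA x / p x)
          = (mix (t \<epsilon>) (qA \<epsilon>) (qB \<epsilon>) x / p x - 1 -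
             \<epsilon> * ((1 - \<theta>) * (hA x / p x) + \<theta> * (hB x / p x))) / \<epsilon>^2"
        using eventually_neq_at_within[of 0 0 UNIV]
      proof eventually_elim
        case (elim \<epsilon>)
        have mix: "mix (t \<epsilon>) (qA \<epsilon>) (qB \<epsilon>) x / p x = (1 - t \<epsilon>) * (qA \<epsilon> x / p x) + t \<epsilon> * (qB \<epsilon> x / p x)" for x
          by (simp add: mix_def add_divide_distrib)
        \<comment> \<open>Brings the weight correction to the denominator
          \<open>\<epsilon>^2\<close> shared by the other terms, so that only numerators remain to
          be compared.\<close>
        have \<sigma>': "\<sigma> \<epsilon> * d = \<epsilon> * (t \<epsilon> - \<theta>) * d / \<epsilon>^2" for d
          using elim by (simp add: \<sigma>_def power2_eq_square)
        have "(1 - t \<epsilon>) * ((a - 1 - \<epsilon> * h) / e) + t \<epsilon> * ((b - 1 - \<epsilon> * k) / e) + \<epsilon> * (t \<epsilon> - \<theta>) * (k - h) / e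
            = ((1 - t \<epsilon>) * a + t \<epsilon> * b - 1 - \<epsilon> * ((1 - \<theta>) * h + \<theta> * k)) / e" for a b h k e
          unfolding times_divide_eq_right add_divide_distrib[symmetric]
          by (rule arg_cong[where f = "\<lambda>z. z / e"]) algebra
        then show ?case unfolding mix \<sigma>' by (intro ballI)
      qed
    qed (simp add: add_divide_distrib diff_divide_distrib right_diff_distrib)
  qed
qed

section \<open>Passage between the weighted norm and essentially uniform limits\<close>

lemma wnorm_finite:
  assumes "wnorm M p h < \<infinity>"
  shows "esslim M (\<lambda>_ x. h x / p x) (\<lambda>x. h x / p x)"
proof -
  have h [measurable]: "h \<in> borel_measurable M"
    using assms by (auto simp: wnorm_def split: if_splits)
  obtain K where K: "0 \<le> K" "wnorm M p h = ennreal K"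
    using assms by (cases "wnorm M p h") auto
  have "AE x in M. ennreal \<bar>h x / p x\<bar> \<le> ennreal K"
    using esssup_AE[where M = M and f = "\<lambda>x. ennreal \<bar>h x / p x\<bar>"] K h by (simp add: wnorm_def)
  then have "AE x in M. \<bar>h x / p x\<bar> \<le> K"
    using K(1) by (simp add: ennreal_le_iff)
  then show ?thesis by (intro esslim_const) measurable
qed

text \<open>Brings the leaf hypotheses, stated in extended reals, into the calculus of
  \<open>esslim\<close>.\<close>

lemma second_order_input:
  assumes h: "wnorm M p h < \<infinity>" and b: "wnorm M p b < \<infinity>"
    and q: "\<forall>\<^sub>F \<epsilon> in at 0. prob_density M (q \<epsilon>)"
    and lim: "((\<lambda>\<epsilon>. wnorm M p (\<lambda>x. q \<epsilon> x - (p x + \<epsilon> * h x + \<epsilon>^2 * b x)) / ennreal (\<epsilon>^2)) \<longlongrightarrow> 0) (at 0)"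
  shows "second_order q h b"
  unfolding second_order_def
proof (intro conjI)
  show "\<forall>\<^sub>F \<epsilon> in at 0. \<forall>x\<in>space M. 0 \<le> q \<epsilon> x"
    using q by eventually_elim (simp add: prob_density_def)
  show "esslim M (\<lambda>_ x. h x / p x) (\<lambda>x. h x / p x)" by (rule wnorm_finite[OF h])
  have [measurable]: "h \<in> borel_measurable M" "b \<in> borel_measurable M"
    using h b by (auto simp: wnorm_def split: if_splits)
  note bb = wnorm_finite[OF b]
  show "esslim M (\<lambda>\<epsilon> x. (q \<epsilon> x / p x - 1 - \<epsilon> * (h x / p x)) / \<epsilon>^2) (\<lambda>x. b x / p x)"
    unfolding esslim_def
  proof (intro conjI allI impI)
    show "\<exists>K. AE x in M. \<bar>b x / p x\<bar> \<le> K" by (rule esslimD(2)[OF bb])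
    show "\<forall>\<^sub>F \<epsilon> in at 0. (\<lambda>x. (q \<epsilon> x / p x - 1 - \<epsilon> * (h x / p x)) / \<epsilon>^2) \<in> borel_measurable M"
      using q
    proof eventually_elim
      case (elim \<epsilon>)
      then have [measurable]: "q \<epsilon> \<in> borel_measurable M" by (simp add: prob_density_def)
      show ?case by measurable
    qed
    fix e :: real assume e: "e > 0"
    from order_tendstoD(2)[OF lim, of "ennreal e"] e
    have "\<forall>\<^sub>F \<epsilon> in at 0. wnorm M p (\<lambda>x. q \<epsilon> x - (p x + \<epsilon> * h x + \<epsilon>^2 * b x)) / ennreal (\<epsilon>^2) < ennreal e"
      by simp
    then show "\<forall>\<^sub>F \<epsilon> in at 0. AE x in M. \<bar>(q \<epsilon> x / p x - 1 - \<epsilon> * (h x / p x)) / \<epsilon>^2 - b x / p x\<bar> < e"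
      using q eventually_neq_at_within[of 0 0 UNIV]
    proof eventually_elim
      case (elim \<epsilon>)
      define F where "F x = q \<epsilon> x - (p x + \<epsilon> * h x + \<epsilon>^2 * b x)" for x
      have [measurable]: "q \<epsilon> \<in> borel_measurable M" using elim(2) by (simp add: prob_density_def)
      have [measurable]: "F \<in> borel_measurable M" unfolding F_def by measurable
      have "esssup M (\<lambda>x. ennreal \<bar>F x / p x\<bar>) < ennreal e * ennreal (\<epsilon>^2)"
        using elim(1,3) by (subst (asm) divide_less_ennreal) (auto simp: wnorm_def simp flip: F_def)
      then have less: "esssup M (\<lambda>x. ennreal \<bar>F x / p x\<bar>) < ennreal (e * \<epsilon>^2)"
        using e by (simp add: ennreal_mult)
      \<comment> \<open>The essential supremum is itself an almost everywhere bound, so a strict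
        bound on it is strict pointwise.\<close>
      have "AE x in M. ennreal \<bar>F x / p x\<bar> < ennreal (e * \<epsilon>^2)"
        using esssup_AE by eventually_elim (rule le_less_trans[OF _ less])
      then show ?case
        using AE_space
      proof eventually_elim
        case (elim x)
        have "\<bar>F x / p x\<bar> < e * \<epsilon>^2"
          using elim(1) by (simp add: ennreal_less_iff)
        then have "\<bar>F x / p x\<bar> / \<epsilon>^2 < e"
          by (subst pos_divide_less_eq) (use \<open>\<epsilon> \<noteq> 0\<close> in auto)
        moreover have "(q \<epsilon> x / p x - 1 - \<epsilon> * (h x / p x)) / \<epsilon>^2 - b x / p x = F x / p x / \<epsilon>^2"
          using \<open>\<epsilon> \<noteq> 0\<close> p_pos[OF elim(2)] by (simp add: F_def field_simps)
        ultimately show ?case by (simp add: abs_mult)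
      qed
    qed
  qed (rule esslimD(1)[OF bb])
qed

text \<open>The way back to the norm. The bound is not strict, since a function below a constant may
  have that constant as essential supremum.\<close>

lemma second_order_wnorm:
  assumes "second_order q h b" "e > 0"
  shows "\<forall>\<^sub>F \<epsilon> in at 0. wnorm M p (\<lambda>x. q \<epsilon> x - (p x + \<epsilon> * h x + \<epsilon>^2 * b x)) \<le> ennreal (e * \<epsilon>^2)"
proof -
  define R where "R \<epsilon> x = (q \<epsilon> x / p x - 1 - \<epsilon> * (h x / p x)) / \<epsilon>^2" for \<epsilon> x
  have R: "esslim M R (\<lambda>x. b x / p x)" using assms by (simp add: second_order_def R_def[abs_def])
  from esslimD(3)[OF R] esslimD(4)[OF R assms(2)] eventually_neq_at_within[of 0 0 UNIV]
  show ?thesis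
  proof eventually_elim
    case (elim \<epsilon>)
    define F where "F x = q \<epsilon> x - (p x + \<epsilon> * h x + \<epsilon>^2 * b x)" for x
    have F: "F x = (R \<epsilon> x - b x / p x) * \<epsilon>^2 * p x" if "x \<in> space M" for x
      using elim(3) p_pos[OF that] by (simp add: F_def R_def field_simps)
    \<comment> \<open>Measurability is recovered through \<open>R\<close>, because
      \<open>wnorm\<close> is \<open>\<infinity>\<close> on non-measurable functions.\<close>
    have "(\<lambda>x. (R \<epsilon> x - b x / p x) * \<epsilon>^2 * p x) \<in> borel_measurable M"
      using elim(1) esslimD(1)[OF R] by measurable
    then have [measurable]: "F \<in> borel_measurable M"
      using measurable_cong[of M F "\<lambda>x. (R \<epsilon> x - b x / p x) * \<epsilon>^2 * p x" borel] F by simp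
    have "AE x in M. ennreal \<bar>F x / p x\<bar> \<le> ennreal (e * \<epsilon>^2)"
      using elim(2) AE_space
    proof eventually_elim
      case (elim x)
      have "F x / p x = (R \<epsilon> x - b x / p x) * \<epsilon>^2" using F p_pos elim(2) by force
      then have "\<bar>F x / p x\<bar> = \<bar>R \<epsilon> x - b x / p x\<bar> * \<epsilon>^2" by (simp add: abs_mult)
      also have "\<dots> \<le> e * \<epsilon>^2" using elim(1) by (intro mult_right_mono) auto
      finally show ?case by (rule ennreal_leI)
    qed
    then have "esssup M (\<lambda>x. ennreal \<bar>F x / p x\<bar>) \<le> ennreal (e * \<epsilon>^2)"
      by (intro esssup_I) measurable
    then show ?case by (simp add: wnorm_def flip: F_def)
  qed
qed

end

section \<open>Propagation through the tree\<close>

lemma leaves_nonempty: "leaves T \<noteq> []"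
  by (induction T) auto

text \<open>A merge cuts the leaf list into two shorter lists; there are finitely many cuts and, by
  induction, finitely many subtrees for each part.\<close>

lemma finite_leaves_eq: "finite {T. leaves T = xs}"
proof (induction "length xs" arbitrary: xs rule: less_induct)
  case less
  \<comment> \<open>The cuts at \<open>0\<close> and \<open>length xs\<close> are left out, as no
    tree has an empty leaf list; this makes both parts shorter.\<close>
  have "{T. leaves T = xs} \<subseteq> Leaf ` set xs \<union>
      (\<Union>k\<in>{0<..<length xs}. case_prod Merge ` ({T. leaves T = take k xs} \<times> {T. leaves T = drop k xs}))"
  proof
    fix T assume "T \<in> {T. leaves T = xs}"
    then show "T \<in> Leaf ` set xs \<union>
      (\<Union>k\<in>{0<..<length xs}. case_prod Merge ` ({T. leaves T = take k xs} \<times> {T. leaves T = drop k xs}))"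
    proof (cases T)
      case (Merge l r)
      with \<open>T \<in> _\<close> have "xs = leaves l @ leaves r" by simp
      then show ?thesis
        using leaves_nonempty[of l] leaves_nonempty[of r] Merge
        by (intro UnI2 UN_I[of "length (leaves l)"]) auto
    qed auto
  qed
  moreover have "finite \<dots>"
    by (intro finite_UnI finite_UN_I finite_imageI finite_cartesian_product less) auto
  ultimately show ?case by (rule finite_subset)
qed

lemma finite_trees: "finite (trees n)"
  unfolding trees_def by (rule finite_leaves_eq)

text \<open>Mass is summed over the set of labels, where a repeated label counts once; distinctness
  restores additivity.\<close>

lemma block_mass_Merge:
  "distinct (leaves (Merge l r)) \<Longrightarrow> block_mass w (Merge l r) = block_mass w l + block_mass w r"
  unfolding block_mass_def leaves.simps set_append by (rule sum.union_disjoint) auto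

lemma block_mass_pos:
  assumes "\<forall>i\<in>set (leaves T). 0 < w i"
  shows "0 < block_mass w T"
  unfolding block_mass_def using assms leaves_nonempty by (intro sum_pos) auto

text \<open>Connects the masses accumulated by the protocol with the sums over labels used in the
  coefficient recursions.\<close>

lemma fst_protocol_state:
  "distinct (leaves T) \<Longrightarrow> fst (protocol_state M f w P T) = block_mass w T"
  by (induction T)
    (auto simp: block_mass_Merge Let_def split_beta simp del: leaves.simps, auto simp: block_mass_def)

text \<open>Each merge averages in proportion to mass, so mass times coefficient adds up over the
  leaves. The first-order coefficient therefore depends on the set of leaves and not on the shape of
  the tree.\<close>

lemma coeff_H_eq:
  assumes "distinct (leaves T)" "\<forall>i\<in>set (leaves T). 0 < w i"
  shows "block_mass w T * coeff_H w h T x = (\<Sum>i\<in>set (leaves T). sqrt (w i) * h i x)"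
  using assms
proof (induction T)
  case (Merge l r)
  have "block_mass w l > 0" "block_mass w r > 0" using Merge.prems by (auto intro!: block_mass_pos)
  then have "block_mass w (Merge l r) * coeff_H w h (Merge l r) x
      = block_mass w l * coeff_H w h l x + block_mass w r * coeff_H w h r x"
    using Merge.prems by (simp add: block_mass_Merge)
  also have "\<dots> = (\<Sum>i\<in>set (leaves (Merge l r)). sqrt (w i) * h i x)"
    using Merge by (simp add: sum.union_disjoint)
  finally show ?case .
qed (simp add: block_mass_def)

text \<open>Stated for arbitrary trees with distinct leaves, because the subtrees met in the
  induction carry only a segment of the labels and leave \<open>trees n\<close>.\<close>

lemma (in perturbation) root_density_second_order:
  assumes "distinct (leaves T)" "\<forall>i\<in>set (leaves T). 0 < w i \<and> second_order (P i) (h i) (B i)"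
    and "\<forall>l r. Merge l r \<in> subtrees T \<longrightarrow>
        0 < (LINT x|M. ((coeff_H w h r x - coeff_H w h l x) / p x)^2 * p x)"
  shows "second_order (root_density M f w P T) (coeff_H w h T) (coeff_B M p f w h B T)"
  using assms
proof (induction T)
  case (Leaf i)
  then show ?case by (simp add: root_density_def)
next
  case (Merge l r)
  have IH: "second_order (root_density M f w P l) (coeff_H w h l) (coeff_B M p f w h B l)"
    "second_order (root_density M f w P r) (coeff_H w h r) (coeff_B M p f w h B r)"
    using Merge.prems by (auto intro!: Merge.IH)
  have mass: "fst (protocol_state M f w P l) = block_mass w l" "fst (protocol_state M f w P r) = block_mass w r"
    using Merge.prems(1) by (auto intro!: fst_protocol_state)
  have pos: "block_mass w l > 0" "block_mass w r > 0" using Merge.prems(2) by (auto intro!: block_mass_pos)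
  have J: "0 < (LINT x|M. ((coeff_H w h r x - coeff_H w h l x) / p x)^2 * p x)"
    using Merge.prems(3) by simp
  have root: "root_density M f w P (Merge l r) = (\<lambda>\<epsilon>. mix (merge_weight M f (block_mass w l) (block_mass w r)
      (root_density M f w P l) (root_density M f w P r) \<epsilon>) (root_density M f w P l \<epsilon>) (root_density M f w P r \<epsilon>))"
    unfolding root_density_def by (simp add: split_beta Let_def mass)
  show ?case
    unfolding root coeff_H.simps coeff_B.simps Let_def
    by (rule second_order_merge[OF IH pos J])
qed

section \<open>Uniform expansion at the root\<close>

theorem theorem6:
  fixes M :: "'a measure" and p :: "'a \<Rightarrow> real" and f :: "real \<Rightarrow> real"
    and n :: nat and w :: "nat \<Rightarrow> real"
    and P :: "nat \<Rightarrow> real \<Rightarrow> 'a \<Rightarrow> real" and h B :: "nat \<Rightarrow> 'a \<Rightarrow> real"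
    and U :: "btree set" and H :: "'a \<Rightarrow> real"
  assumes "prob_density M p" and "\<forall>x\<in>space M. 0 < p x"
    and "generator f"
    and "n \<ge> 2"
    and "\<forall>i\<in>{1..n}. 0 < w i"
    and "\<forall>i\<in>{1..n}. wnorm M p (h i) < \<infinity> \<and> (LINT x|M. h i x) = 0"
    and "\<forall>i\<in>{1..n}. wnorm M p (B i) < \<infinity> \<and> (LINT x|M. B i x) = 0"
    and "\<forall>i\<in>{1..n}. \<forall>\<^sub>F \<epsilon> in at 0. prob_density M (P i \<epsilon>)"
    and "\<forall>i\<in>{1..n}. ((\<lambda>\<epsilon>. wnorm M p (\<lambda>x. P i \<epsilon> x - (p x + \<epsilon> * h i x + \<epsilon>^2 * B i x))
                               / ennreal (\<epsilon>^2)) \<longlongrightarrow> 0) (at 0)"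
    and "admissible M p f w h B n U"
  defines "H \<equiv> (\<lambda>x. (\<Sum>i=1..n. sqrt (w i) * h i x) / (\<Sum>i=1..n. sqrt (w i)))"
  shows "((\<lambda>\<epsilon>. (SUP T\<in>U. wnorm M p (\<lambda>x. root_density M f w P T \<epsilon> x
                   - (p x + \<epsilon> * H x + \<epsilon>^2 * coeff_B M p f w h B T x)))
              / ennreal (\<epsilon>^2)) \<longlongrightarrow> 0) (at 0)"
proof -
  interpret perturbation M p f
    using assms(1-3) by unfold_locales auto
  note wpos = assms(5)
  have U: "U \<subseteq> trees n" and J: "\<And>T l r. T \<in> U \<Longrightarrow> Merge l r \<in> subtrees T \<Longrightarrow>
        0 < (LINT x|M. ((coeff_H w h r x - coeff_H w h l x) / p x)^2 * p x)"
    using assms(10) by (auto simp: admissible_def)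
  have leaves: "leaves T = [1..<Suc n]" "distinct (leaves T)" "set (leaves T) = {1..n}" if "T \<in> U" for T
    using that U by (auto simp: trees_def simp del: upt_Suc)
  have input: "second_order (P i) (h i) (B i)" if "i \<in> {1..n}" for i
    using that assms(6-9) by (intro second_order_input) auto
  \<comment> \<open>All trees in \<open>U\<close> have the same leaf set, so dividing
    \<open>coeff_H_eq\<close> by the total mass gives one and the same function.\<close>
  have H: "coeff_H w h T = H" if "T \<in> U" for T
  proof
    fix x
    have "block_mass w T = (\<Sum>i=1..n. sqrt (w i))" by (simp add: block_mass_def leaves(3)[OF that])
    moreover have "block_mass w T > 0" using wpos leaves(3)[OF that] by (intro block_mass_pos) auto
    moreover have "block_mass w T * coeff_H w h T x = (\<Sum>i=1..n. sqrt (w i) * h i x)"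
      using coeff_H_eq[OF leaves(2)[OF that], of w h x] wpos by (simp add: leaves(3)[OF that])
    ultimately show "coeff_H w h T x = H x" unfolding H_def by (simp add: field_simps)
  qed
  have root: "second_order (root_density M f w P T) H (coeff_B M p f w h B T)" if "T \<in> U" for T
    unfolding H[OF that, symmetric]
    by (rule root_density_second_order)
      (use leaves(2,3)[OF that] wpos input J[OF that] in auto)
  let ?R = "\<lambda>T \<epsilon>. wnorm M p (\<lambda>x. root_density M f w P T \<epsilon> x
                   - (p x + \<epsilon> * H x + \<epsilon>^2 * coeff_B M p f w h B T x))"
  show ?thesis
  proof (rule tendsto_zero_ennreal)
    fix e :: real assume e: "0 < e"
    \<comment> \<open>Finitely many trees allow one threshold for all of them; \<open>e / 2\<close>
      leaves room for the strict bound on the supremum.\<close>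
    have "\<forall>\<^sub>F \<epsilon> in at 0. \<forall>T\<in>U. ?R T \<epsilon> \<le> ennreal (e / 2 * \<epsilon>^2)"
      using finite_subset[OF U finite_trees] e
      by (intro eventually_ball_finite ballI second_order_wnorm root) auto
    then show "\<forall>\<^sub>F \<epsilon> in at 0. (SUP T\<in>U. ?R T \<epsilon>) / ennreal (\<epsilon>^2) < ennreal e"
      using eventually_neq_at_within[of 0 0 UNIV]
    proof eventually_elim
      case (elim \<epsilon>)
      have "(SUP T\<in>U. ?R T \<epsilon>) \<le> ennreal (e / 2 * \<epsilon>^2)"
        using elim(1) by (intro SUP_least) auto
      also have "\<dots> < ennreal (e * \<epsilon>^2)"
        using e elim(2) by (intro ennreal_lessI) auto
      also have "\<dots> = ennreal e * ennreal (\<epsilon>^2)" using e by (simp add: ennreal_mult)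
      finally show ?case using elim(2) by (subst divide_less_ennreal) auto
    qed
  qed
qed

end
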